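(* Let $\mathbf b(z):=\sum_{i\in\mathbb Z}b_iz^i\in M[[z^{-1},z]]$. Then for all $\phi\in F$, $$\mathbf b(z)\wedge\phi=R(z)\,\sigma_+(z)\,\overline\sigma_-(z)\,\phi.$$
   Context: Exterior algebra and Schubert derivations. $M=\bigoplus_{i\in\mathbb Z}\mathbb Z b_i$ is a free abelian group with basis $(b_i)_{i\in\mathbb Z}$, $\bigwedge M$ its exterior algebra over $\mathbb Z$. A Hasse–Schmidt (HS) derivation on $\bigwedge M$ is a $\mathbb Z$-linear map $\mathcal D(z):\bigwedge M\to\bigwedge M[[z]]$ (or $\bigwedge M[[z^{-1}]]$) with $\mathcal D(z)(u\wedge v)=\mathcal D(z)u\wedge\mathcal D(z)v$. $\sigma_+(z)$ is the unique HS derivation with $\sigma_+(z)b_j=\sum_{i\ge0}b_{j+i}z^i$; $\overline\sigma_-(z)$ is the unique HS derivation with $\overline\sigma_-(z)b_j=b_j-b_{j-1}z^{-1}$. Fermionic Fock space. $\mathcal P$ is the set of partitions, $\mathcal P_r$ those of length $\ell(\lambda)\le r$. For $\lambda\in\mathcal P_r$, $\mathbf b^r_{m+\lambda}:=b_{m+\lambda_1}\wedge b_{m-1+\lambda_2}\wedge\cdots\wedge b_{m-r+1+\lambda_r}$. Let $[M]$ be the free $\mathbb Z$-module with basis $([\mathbf b]_m)_{m\in\mathbb Z}$, and $F:=(\bigwedge M\otimes_{\mathbb Z}[M])/W$ where $W$ is the $\bigwedge M$-submodule generated by all $b_m\otimes[\mathbf b]_{m-1}-1\otimes[\mathbf b]_m$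 and $b_m\otimes[\mathbf b]_m$, $m\in\mathbb Z$. The class of $u\otimes[\mathbf b]_m$ is written $u\wedge[\mathbf b]_m$, and the $\bigwedge M$-module action on $F$ is written $\wedge$. Put $[\mathbf b]_{m+\lambda}:=\mathbf b^r_{m+\lambda}\wedge[\mathbf b]_{m-r}$ for any $r\ge\ell(\lambda)$ (independent of $r$). Then $F=\bigoplus_m F_m$, $F_m=\bigoplus_{\lambda\in\mathcal P}\mathbb Z[\mathbf b]_{m+\lambda}$. Extension to $F$. Put $\sigma_+(z)[\mathbf b]_m=(\sigma_+(z)b_m)\wedge[\mathbf b]_{m-1}$, $\overline\sigma_-(z)[\mathbf b]_m=[\mathbf b]_m$, and for $\tau(z)\in\{\sigma_+(z),\overline\sigma_-(z)\}$ put $\tau(z)[\mathbf b]_{m+\lambda}=\tau(z)\mathbf b^r_{m+\lambda}\wedge\tau(z)[\mathbf b]_{m-r}$ ($r\ge\ell(\lambda)$), extended $\mathbb Z$-linearly. Compositions are right to left, applied coefficientwise. $R(z)$ is the $\mathbb Z[z,z^{-1}]$-linear operator given by $R(z)[\mathbf b]_{m+\lambda}=z^{m+1}[\mathbf b]_{m+1+\lambda}$ (applied coefficientwise to formal series). *)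

theory Defs
  imports "HOL-Library.Poly_Mapping" "HOL-Computational_Algebra.Formal_Power_Series"
begin

section \<open>The exterior algebra of $M = \bigoplus_{i \in \mathbb{Z}} \mathbb{Z} b_i$\<close>

text \<open>
  Lists form the free monoid under concatenation, written additively so that
  finitely supported functions on words carry the convolution product.
  Since \<open>M\<close> is free on the \<open>b\<^sub>i\<close>, its tensor algebra is the monoid ring
  of words in \<open>int\<close>: the word \<open>[i\<^sub>1, \<dots>, i\<^sub>k]\<close> stands for the tensor
  product of \<open>b\<close> at \<open>i\<^sub>1\<close>, \<open>\<dots>\<close>, \<open>i\<^sub>k\<close>, and \<open>M\<close> itself is the span of the words of length one.
\<close>

instantiation list :: (type) monoid_add
begin

definition zero_list :: "'a list" where "zero_list = []"

definition plus_list :: "'a list \<Rightarrow> 'a list \<Rightarrow> 'a list" where "plus_list xs ys = xs @ ys"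

instance
  by standard (simp_all add: zero_list_def plus_list_def)

end

type_synonym tensor = "int list \<Rightarrow>\<^sub>0 int"

definition tensor_M :: "tensor set" where
  "tensor_M = {x. \<forall>w \<in> Poly_Mapping.keys x. length w = 1}"

text \<open>The two-sided ideal generated by the squares of elements of \<open>M\<close>.\<close>

inductive_set ext_ideal :: "tensor set" where
  square: "m \<in> tensor_M \<Longrightarrow> m * m \<in> ext_ideal"
| zero: "0 \<in> ext_ideal"
| add: "x \<in> ext_ideal \<Longrightarrow> y \<in> ext_ideal \<Longrightarrow> x + y \<in> ext_ideal"
| mult_left: "x \<in> ext_ideal \<Longrightarrow> a * x \<in> ext_ideal"
| mult_right: "x \<in> ext_ideal \<Longrightarrow> x * a \<in> ext_ideal"

lemma ext_ideal_uminus: "x \<in> ext_ideal \<Longrightarrow> - x \<in> ext_ideal"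
  using ext_ideal.mult_left[of x "- 1"] by simp

lemma ext_ideal_diff: "x \<in> ext_ideal \<Longrightarrow> y \<in> ext_ideal \<Longrightarrow> x - y \<in> ext_ideal"
  using ext_ideal.add[of x "- y"] ext_ideal_uminus[of y] by simp

lemma lookup_mult_Nil:
  fixes x y :: tensor
  shows "Poly_Mapping.lookup (x * y) [] = Poly_Mapping.lookup x [] * Poly_Mapping.lookup y []"
proof -
  have "(\<Sum>q. Poly_Mapping.lookup y q when [] = l + q) = (Poly_Mapping.lookup y [] when l = [])" for l
  proof -
    have "(\<lambda>q. Poly_Mapping.lookup y q when [] = l + q)
        = (\<lambda>q. (Poly_Mapping.lookup y [] when l = []) when q = [])"
      by (auto simp: fun_eq_iff plus_list_def when_def)
    then show ?thesis by (simp only: Sum_any_when_equal)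
  qed
  then have "Poly_Mapping.lookup (x * y) []
      = (\<Sum>l. Poly_Mapping.lookup x l * (Poly_Mapping.lookup y [] when l = []))"
    by (simp add: lookup_mult)
  also have "\<dots> = (\<Sum>l::int list. (Poly_Mapping.lookup x [] * Poly_Mapping.lookup y []) when l = [])"
    by (rule arg_cong[where f = Sum_any]) (auto simp: fun_eq_iff when_def)
  finally show ?thesis by (simp only: Sum_any_when_equal)
qed

lemma ext_ideal_lookup_Nil: "x \<in> ext_ideal \<Longrightarrow> Poly_Mapping.lookup x [] = 0"
proof (induction rule: ext_ideal.induct)
  case (square m)
  then have "[] \<notin> Poly_Mapping.keys m" by (auto simp: tensor_M_def)
  then show ?case by (simp add: lookup_mult_Nil in_keys_iff)
qed (simp_all add: lookup_mult_Nil lookup_add)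

lemma one_notin_ext_ideal: "1 \<notin> ext_ideal"
  using ext_ideal_lookup_Nil[of 1] by (auto simp: lookup_one zero_list_def)

definition ext_rel :: "tensor \<Rightarrow> tensor \<Rightarrow> bool" where
  "ext_rel x y \<longleftrightarrow> x - y \<in> ext_ideal"

quotient_type ext = tensor / ext_rel
proof (rule equivpI)
  show "reflp ext_rel" by (simp add: reflp_def ext_rel_def ext_ideal.zero)
  show "symp ext_rel"
    by (metis ext_ideal_uminus ext_rel_def minus_diff_eq sympI)
  show "transp ext_rel"
  proof (rule transpI)
    fix x y z assume "ext_rel x y" "ext_rel y z"
    then show "ext_rel x z"
      using ext_ideal.add[of "x - y" "y - z"] by (simp add: ext_rel_def)
  qed
qed

text \<open>The product \<open>*\<close> of \<^typ>\<open>ext\<close> is the wedge product.\<close>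

instantiation ext :: ring_1
begin

lift_definition zero_ext :: ext is 0 .

lift_definition one_ext :: ext is 1 .

lift_definition plus_ext :: "ext \<Rightarrow> ext \<Rightarrow> ext" is plus
  by (metis (no_types, lifting) add_diff_add ext_ideal.add ext_rel_def)

lift_definition uminus_ext :: "ext \<Rightarrow> ext" is uminus
  by (metis (no_types, lifting) ext_ideal_uminus ext_rel_def minus_diff_minus)

lift_definition minus_ext :: "ext \<Rightarrow> ext \<Rightarrow> ext" is minus
proof -
  fix a b c d :: tensor assume "ext_rel a b" "ext_rel c d"
  then show "ext_rel (a - c) (b - d)"
    using ext_ideal_diff[of "a - b" "c - d"] by (simp add: ext_rel_def algebra_simps)
qed

lift_definition times_ext :: "ext \<Rightarrow> ext \<Rightarrow> ext" is times
proof -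
  fix a b c d :: tensor assume "ext_rel a b" "ext_rel c d"
  then have "(a - b) * c + b * (c - d) \<in> ext_ideal"
    by (auto simp: ext_rel_def intro: ext_ideal.intros)
  then show "ext_rel (a * c) (b * d)" by (simp add: ext_rel_def algebra_simps)
qed

instance
proof
  show "(0 :: ext) \<noteq> 1"
    by transfer (use one_notin_ext_ideal ext_ideal_uminus[of "-1"] in \<open>auto simp: ext_rel_def\<close>)
qed (transfer; simp add: ext_rel_def ext_ideal.zero algebra_simps)+

end

lift_definition bvec :: "int \<Rightarrow> ext" is "\<lambda>i. Poly_Mapping.single [i] 1" .


section \<open>The fermionic Fock space\<close>

text \<open>
  The tensor product of the exterior algebra with the free abelian group on the
  symbols \<open>[b]\<^sub>m\<close> is the free left module on these symbols; the element
  \<open>Poly_Mapping.single m u\<close> stands for \<open>u \<otimes> [b]\<^sub>m\<close>.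
\<close>

type_synonym prefock = "int \<Rightarrow>\<^sub>0 ext"

definition prefock_act :: "ext \<Rightarrow> prefock \<Rightarrow> prefock" where
  "prefock_act u = Poly_Mapping.map ((*) u)"

lemma lookup_prefock_act [simp]:
  "Poly_Mapping.lookup (prefock_act u x) m = u * Poly_Mapping.lookup x m"
  by (simp add: prefock_act_def Poly_Mapping.map.rep_eq when_def)

inductive_set fock_W :: "prefock set" where
  absorb: "Poly_Mapping.single (m - 1) (bvec m) - Poly_Mapping.single m 1 \<in> fock_W"
| kill: "Poly_Mapping.single m (bvec m) \<in> fock_W"
| zero: "0 \<in> fock_W"
| add: "x \<in> fock_W \<Longrightarrow> y \<in> fock_W \<Longrightarrow> x + y \<in> fock_W"
| act: "x \<in> fock_W \<Longrightarrow> prefock_act u x \<in> fock_W"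

lemma fock_W_uminus: "x \<in> fock_W \<Longrightarrow> - x \<in> fock_W"
proof -
  assume "x \<in> fock_W"
  moreover have "prefock_act (- 1) x = - x" by (rule poly_mapping_eqI) simp
  ultimately show ?thesis using fock_W.act[of x "- 1"] by simp
qed

lemma fock_W_diff: "x \<in> fock_W \<Longrightarrow> y \<in> fock_W \<Longrightarrow> x - y \<in> fock_W"
  using fock_W.add[of x "- y"] fock_W_uminus[of y] by simp

definition fock_rel :: "prefock \<Rightarrow> prefock \<Rightarrow> bool" where
  "fock_rel x y \<longleftrightarrow> x - y \<in> fock_W"

quotient_type fock = prefock / fock_rel
proof (rule equivpI)
  show "reflp fock_rel" by (simp add: reflp_def fock_rel_def fock_W.zero)
  show "symp fock_rel"
    by (metis fock_W_uminus fock_rel_def minus_diff_eq sympI)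
  show "transp fock_rel"
  proof (rule transpI)
    fix x y z assume "fock_rel x y" "fock_rel y z"
    then show "fock_rel x z"
      using fock_W.add[of "x - y" "y - z"] by (simp add: fock_rel_def)
  qed
qed

instantiation fock :: ab_group_add
begin

lift_definition zero_fock :: fock is 0 .

lift_definition plus_fock :: "fock \<Rightarrow> fock \<Rightarrow> fock" is plus
  by (metis (no_types, lifting) add_diff_add fock_W.add fock_rel_def)

lift_definition uminus_fock :: "fock \<Rightarrow> fock" is uminus
  by (metis (no_types, lifting) fock_W_uminus fock_rel_def minus_diff_minus)

lift_definition minus_fock :: "fock \<Rightarrow> fock \<Rightarrow> fock" is minus
proof -
  fix a b c d :: prefock assume "fock_rel a b" "fock_rel c d"
  then show "fock_rel (a - c) (b - d)"
    using fock_W_diff[of "a - b" "c - d"] by (simp add: fock_rel_def algebra_simps)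
qed

instance
  by standard (transfer; simp add: fock_rel_def fock_W.zero algebra_simps)+

end

lift_definition wedge :: "ext \<Rightarrow> fock \<Rightarrow> fock" (infixr "\<and>\<^sub>F" 75) is prefock_act
proof -
  fix u :: ext and x y :: prefock assume "fock_rel x y"
  moreover have "prefock_act u x - prefock_act u y = prefock_act u (x - y)"
    by (rule poly_mapping_eqI) (simp add: lookup_minus algebra_simps)
  ultimately show "fock_rel (prefock_act u x) (prefock_act u y)"
    by (simp add: fock_rel_def fock_W.act)
qed

lift_definition vac :: "int \<Rightarrow> fock" is "\<lambda>m. Poly_Mapping.single m 1" .

lemma wedge_one [simp]: "1 \<and>\<^sub>F \<phi> = \<phi>"
proof (induction \<phi> rule: fock.abs_induct)
  case (1 x)
  have "prefock_act 1 x = x" by (rule poly_mapping_eqI) simp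
  then show ?case by (simp add: wedge.abs_eq)
qed

lemma wedge_wedge: "u \<and>\<^sub>F v \<and>\<^sub>F \<phi> = (u * v) \<and>\<^sub>F \<phi>"
proof (induction \<phi> rule: fock.abs_induct)
  case (1 x)
  have "prefock_act u (prefock_act v x) = prefock_act (u * v) x"
    by (rule poly_mapping_eqI) (simp add: mult.assoc)
  then show ?case by (simp add: wedge.abs_eq)
qed

lemma wedge_add_left: "(u + v) \<and>\<^sub>F \<phi> = u \<and>\<^sub>F \<phi> + v \<and>\<^sub>F \<phi>"
proof (induction \<phi> rule: fock.abs_induct)
  case (1 x)
  have "prefock_act (u + v) x = prefock_act u x + prefock_act v x"
    by (rule poly_mapping_eqI) (simp add: lookup_add algebra_simps)
  then show ?case by (simp add: wedge.abs_eq plus_fock.abs_eq)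
qed

lemma wedge_add_right: "u \<and>\<^sub>F (\<phi> + \<psi>) = u \<and>\<^sub>F \<phi> + u \<and>\<^sub>F \<psi>"
proof (induction \<phi> rule: fock.abs_induct)
  case (1 x)
  show ?case
  proof (induction \<psi> rule: fock.abs_induct)
    case (1 y)
    have "prefock_act u (x + y) = prefock_act u x + prefock_act u y"
      by (rule poly_mapping_eqI) (simp add: lookup_add algebra_simps)
    then show ?case by (simp add: wedge.abs_eq plus_fock.abs_eq)
  qed
qed

lemma prefock_act_single:
  "prefock_act u (Poly_Mapping.single m v) = Poly_Mapping.single m (u * v)"
  by (rule poly_mapping_eqI) (simp add: lookup_single when_def)

lemma bvec_wedge_vac: "bvec m \<and>\<^sub>F vac (m - 1) = vac m"
  by transfer (simp add: fock_rel_def prefock_act_single fock_W.absorb)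

lemma bvec_wedge_vac_same: "bvec m \<and>\<^sub>F vac m = 0"
  by transfer (simp add: fock_rel_def prefock_act_single fock_W.kill)


section \<open>Partitions and the basis elements\<close>

text \<open>Parts are indexed from zero: the part \<open>\<lambda>\<^sub>i\<close>, \<open>i \<ge> 1\<close>, is \<open>l (i - 1)\<close>.\<close>

definition partitions :: "(nat \<Rightarrow> nat) set" where
  "partitions = {l. decseq l \<and> finite {i. l i \<noteq> 0}}"

definition plen :: "(nat \<Rightarrow> nat) \<Rightarrow> nat" where
  "plen l = card {i. l i \<noteq> 0}"

definition bwedge :: "nat \<Rightarrow> int \<Rightarrow> (nat \<Rightarrow> nat) \<Rightarrow> ext" where
  "bwedge r m l = prod_list (map (\<lambda>i. bvec (m - int i + int (l i))) [0..<r])"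

definition fbasis :: "int \<Rightarrow> (nat \<Rightarrow> nat) \<Rightarrow> fock" where
  "fbasis m l = bwedge (plen l) m l \<and>\<^sub>F vac (m - int (plen l))"

lemma partition_zero_beyond_length:
  assumes "l \<in> partitions" and "plen l \<le> i"
  shows "l i = 0"
proof (rule ccontr)
  assume "l i \<noteq> 0"
  moreover have "decseq l" and fin: "finite {i. l i \<noteq> 0}"
    using assms by (auto simp: partitions_def)
  ultimately have "{..i} \<subseteq> {i. l i \<noteq> 0}"
    using decseqD by fastforce
  from card_mono[OF fin this] show False using assms by (simp add: plen_def)
qed

lemma fbasis_eq:
  assumes "l \<in> partitions" and "plen l \<le> r"
  shows "fbasis m l = bwedge r m l \<and>\<^sub>F vac (m - int r)"
  using assms(2)
proof (induction r rule: dec_induct)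
  case base
  show ?case by (simp add: fbasis_def)
next
  case (step r)
  have "l r = 0" using partition_zero_beyond_length assms(1) step by simp
  then have "bwedge (Suc r) m l = bwedge r m l * bvec (m - int r)"
    by (simp add: bwedge_def)
  then show ?case
    using step.IH bvec_wedge_vac[of "m - int r"]
    by (simp add: algebra_simps flip: wedge_wedge)
qed


section \<open>Schubert derivations\<close>

text \<open>
  Series in \<open>z\<close> and series in \<open>z\<^sup>-\<^sup>1\<close> are both represented by \<^typ>\<open>ext fps\<close>; in
  the second case the variable of the power series is \<open>z\<^sup>-\<^sup>1\<close>.
  A map of abelian groups is \<open>\<int>\<close>-linear iff it is additive. The condition \<open>D 1 = 1\<close> is not
  part of the definition, but it holds for the two derivations below: \<open>1 - D 1\<close> annihilates
  every \<open>D (bvec j)\<close>, which forces it to vanish. So their values on the \<open>bvec j\<close> determine them.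
\<close>

definition HS_derivation :: "(ext \<Rightarrow> ext fps) \<Rightarrow> bool" where
  "HS_derivation D \<longleftrightarrow> additive D \<and> (\<forall>u v. D (u * v) = D u * D v)"

definition sigma_plus :: "ext \<Rightarrow> ext fps" where
  "sigma_plus = (THE D. HS_derivation D \<and> (\<forall>j. D (bvec j) = Abs_fps (\<lambda>i. bvec (j + int i))))"

definition sigma_minus_bar :: "ext \<Rightarrow> ext fps" where
  "sigma_minus_bar = (THE D. HS_derivation D \<and>
     (\<forall>j. D (bvec j) = fps_const (bvec j) - fps_const (bvec (j - 1)) * fps_X))"

definition wedge_fps :: "ext fps \<Rightarrow> fock fps \<Rightarrow> fock fps" where
  "wedge_fps f g = Abs_fps (\<lambda>n. \<Sum>i\<le>n. fps_nth f i \<and>\<^sub>F fps_nth g (n - i))"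

text \<open>
  The extension to \<^typ>\<open>fock\<close> of a derivation \<open>D\<close>, given its values \<open>v m\<close> at \<open>[b]\<^sub>m\<close>.
  It is determined because the elements \<open>fbasis m l\<close> form a \<open>\<int>\<close>-basis of \<^typ>\<open>fock\<close>.
\<close>

definition fock_extension :: "(ext \<Rightarrow> ext fps) \<Rightarrow> (int \<Rightarrow> fock fps) \<Rightarrow> fock \<Rightarrow> fock fps" where
  "fock_extension D v = (THE T. additive T \<and> (\<forall>m. T (vac m) = v m) \<and>
     (\<forall>m. \<forall>l \<in> partitions. \<forall>r \<ge> plen l.
        T (fbasis m l) = wedge_fps (D (bwedge r m l)) (T (vac (m - int r)))))"

definition sigma_plus_fock :: "fock \<Rightarrow> fock fps" where
  "sigma_plus_fock = fock_extension sigma_plus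
     (\<lambda>m. wedge_fps (sigma_plus (bvec m)) (fps_const (vac (m - 1))))"

definition sigma_minus_bar_fock :: "fock \<Rightarrow> fock fps" where
  "sigma_minus_bar_fock = fock_extension sigma_minus_bar (\<lambda>m. fps_const (vac m))"

text \<open>The value of \<open>R(z)\<close> on \<^typ>\<open>fock\<close>, a Laurent polynomial in \<open>z\<close>.\<close>

definition R_fock :: "fock \<Rightarrow> (int \<Rightarrow>\<^sub>0 fock)" where
  "R_fock = (THE T. additive T \<and>
     (\<forall>m. \<forall>l \<in> partitions. T (fbasis m l) = Poly_Mapping.single (m + 1) (fbasis (m + 1) l)))"


section \<open>Two-sided formal series\<close>

text \<open>
  A two-sided formal series \<open>\<Sum>\<^sub>n f\<^sub>n z\<^sup>n\<close> is the function \<open>n \<mapsto> f\<^sub>n\<close> on \<^typ>\<open>int\<close>.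
\<close>

definition series_pos :: "'a::zero fps \<Rightarrow> int \<Rightarrow> 'a" where
  "series_pos f n = (if 0 \<le> n then fps_nth f (nat n) else 0)"

definition series_neg :: "'a::zero fps \<Rightarrow> int \<Rightarrow> 'a" where
  "series_neg f n = (if n \<le> 0 then fps_nth f (nat (- n)) else 0)"

text \<open>
  Coefficientwise application to \<open>\<Sum>\<^sub>k f\<^sub>k z\<^sup>k\<close> of an operator \<open>T\<close> with values in two-sided
  series: the result is \<open>\<Sum>\<^sub>k T(f\<^sub>k) z\<^sup>k\<close>. It is meaningful only if each coefficient is a
  finite sum (the sum over all \<open>k\<close> is \<open>0\<close> by convention otherwise). In
  \<open>R_op (sigma_plus_op (series_neg (sigma_minus_bar_fock \<phi>)))\<close> all these sums have finite support: \<open>sigma_minus_bar_fock \<phi>\<close> is a polynomial in \<open>z\<^sup>-\<^sup>1\<close>, the coefficients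
  of \<open>sigma_plus_fock\<close> and \<open>sigma_minus_bar_fock\<close> preserve the charge \<open>m\<close>, and only finitely
  many charges occur in \<open>\<phi>\<close>, each of which \<open>R_fock\<close> multiplies by a single power of \<open>z\<close>.
\<close>

definition coeffwise :: "(fock \<Rightarrow> int \<Rightarrow> fock) \<Rightarrow> (int \<Rightarrow> fock) \<Rightarrow> (int \<Rightarrow> fock)" where
  "coeffwise T f = (\<lambda>n. \<Sum>k. T (f k) (n - k))"

definition sigma_plus_op :: "(int \<Rightarrow> fock) \<Rightarrow> (int \<Rightarrow> fock)" where
  "sigma_plus_op = coeffwise (\<lambda>\<phi>. series_pos (sigma_plus_fock \<phi>))"

definition R_op :: "(int \<Rightarrow> fock) \<Rightarrow> (int \<Rightarrow> fock)" where
  "R_op = coeffwise (\<lambda>\<phi>. Poly_Mapping.lookup (R_fock \<phi>))"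

definition bseries :: "int \<Rightarrow> ext" where
  "bseries i = bvec i"

definition wedge_series :: "(int \<Rightarrow> ext) \<Rightarrow> fock \<Rightarrow> (int \<Rightarrow> fock)" where
  "wedge_series f \<phi> = (\<lambda>n. f n \<and>\<^sub>F \<phi>)"

end

theory Submission
  imports Defs "HOL-Library.Product_Plus"
begin

text \<open>
  Both sides are additive in \<open>\<phi>\<close>, so it suffices to treat the vacua \<open>[b]\<^sub>m\<close> and to compare both sides
  at \<open>b\<^sub>i \<and> \<phi>\<close> and at \<open>\<phi>\<close>. Since \<open>\<sigma>\<^sub>+(z) b\<^sub>i\<^sub>-\<^sub>1 = b\<^sub>i\<^sub>-\<^sub>1 + z \<sigma>\<^sub>+(z) b\<^sub>i\<close>, the composite of the two
  Schubert derivations maps \<open>b\<^sub>i\<close> to \<open>- z\<^sup>-\<^sup>1 b\<^sub>i\<^sub>-\<^sub>1\<close>. The shift \<open>R(z)\<close> undoes this up to the sign, so the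
  right-hand side at \<open>b\<^sub>i \<and> \<phi>\<close> is \<open>- b\<^sub>i\<close> wedged with its value at \<open>\<phi>\<close>. The left-hand side obeys the same
  rule because \<open>b(z)\<close> anticommutes with \<open>b\<^sub>i\<close>. At the vacuum the two sides agree as \<open>b\<^sub>i \<and> [b]\<^sub>m = 0\<close>
  for \<open>i \<le> m\<close>.

  The operators defined by definite descriptions exist by the universal properties of the exterior
  algebra (for operators with \<open>F\<^sub>i F\<^sub>i = 0\<close> and \<open>F\<^sub>i F\<^sub>j = - F\<^sub>j F\<^sub>i\<close>) and of the Fock space. For
  uniqueness on the Fock space only the fact that the \<open>[b]\<^sub>m\<^sub>+\<^sub>\<lambda>\<close> span is needed, not their linear independence.
\<close>

section \<open>Universal properties\<close>

definition pm_sum :: "('a \<Rightarrow> 'b \<Rightarrow> 'c) \<Rightarrow> ('a \<Rightarrow>\<^sub>0 'b::zero) \<Rightarrow> 'c::comm_monoid_add" where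
  "pm_sum g x = (\<Sum>w\<in>Poly_Mapping.keys x. g w (Poly_Mapping.lookup x w))"

lemma pm_sum_superset:
  assumes "\<And>w. g w 0 = 0" "finite S" "Poly_Mapping.keys x \<subseteq> S"
  shows "pm_sum g x = (\<Sum>w\<in>S. g w (Poly_Mapping.lookup x w))"
  unfolding pm_sum_def
  by (rule sum.mono_neutral_left) (use assms in \<open>auto simp: in_keys_iff\<close>)

lemma pm_sum_add:
  assumes "\<And>w. g w 0 = 0" "\<And>w c d. g w (c + d) = g w c + g w d"
  shows "pm_sum g (x + y) = pm_sum g x + pm_sum g y"
proof -
  let ?S = "Poly_Mapping.keys x \<union> Poly_Mapping.keys y"
  have "Poly_Mapping.keys (x + y) \<subseteq> ?S" by (rule Poly_Mapping.keys_add)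
  then show ?thesis
    by (simp add: pm_sum_superset[of g ?S] assms lookup_add sum.distrib)
qed

lemma pm_sum_single:
  assumes "g w 0 = 0"
  shows "pm_sum g (Poly_Mapping.single w c) = g w c"
  using assms by (cases "c = 0") (simp_all add: pm_sum_def)

text \<open>Integer multiples in an abstract abelian group. Since \<open>nat\<close> truncates at
  zero, at most one of the two sums is nonempty.\<close>

definition int_scale :: "int \<Rightarrow> 'n::ab_group_add \<Rightarrow> 'n" where
  "int_scale k a = (\<Sum>_<nat k. a) - (\<Sum>_<nat (- k). a)"

lemma int_scale_Suc: "int_scale (k + 1) a = int_scale k a + a"
proof (cases "k \<ge> 0")
  case True
  then have "nat (k + 1) = Suc (nat k)" by simp
  with True show ?thesis by (simp add: int_scale_def)
next
  case False
  then have "nat (- k) = Suc (nat (- (k + 1)))" by simp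
  with False show ?thesis by (simp add: int_scale_def)
qed

lemma int_scale_add: "int_scale (k + l) a = int_scale k a + int_scale l a"
proof (induction l rule: int_induct[of _ 0])
  case base
  show ?case by (simp add: int_scale_def)
next
  case (step1 i)
  then show ?case
    using int_scale_Suc[of "k + i" a] int_scale_Suc[of i a] by (simp add: algebra_simps)
next
  case (step2 i)
  then show ?case
    using int_scale_Suc[of "k + (i - 1)" a] int_scale_Suc[of "i - 1" a] by (simp add: algebra_simps)
qed

lemma int_scale_add_right: "int_scale k (a + b) = int_scale k a + int_scale k b"
  by (simp add: int_scale_def sum.distrib)

lemma additive_uminus_diff:
  fixes f :: "'a::ab_group_add \<Rightarrow> 'b::ab_group_add"
  assumes "\<And>x y. f (x + y) = f x + f y"
  shows "f 0 = 0" "f (- x) = - f x" "f (x - y) = f x - f y"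
proof -
  interpret additive f by standard (rule assms)
  show "f 0 = 0" "f (- x) = - f x" "f (x - y) = f x - f y" by (rule zero minus diff)+
qed

section \<open>Modules over the exterior algebra from odd operators\<close>

locale odd_operators =
  fixes F :: "int \<Rightarrow> 'n::ab_group_add \<Rightarrow> 'n"
  assumes F_add: "F i (x + y) = F i x + F i y"
    and F_square: "F i (F i x) = 0"
    and F_anticommute: "F i (F j x) = - F j (F i x)"
begin

definition tensor_act :: "tensor \<Rightarrow> 'n \<Rightarrow> 'n" where
  "tensor_act x n = pm_sum (\<lambda>w c. int_scale c (foldr F w n)) x"

lemma tensor_act_add: "tensor_act (x + y) n = tensor_act x n + tensor_act y n"
  unfolding tensor_act_def by (rule pm_sum_add) (simp add: int_scale_def, rule int_scale_add)

lemma tensor_act_add_right: "tensor_act x (m + n) = tensor_act x m + tensor_act x n"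
proof -
  have "foldr F w (m + n) = foldr F w m + foldr F w n" for w
    by (induction w) (simp_all add: F_add)
  then show ?thesis by (simp add: tensor_act_def pm_sum_def int_scale_add_right sum.distrib)
qed

lemmas tensor_act_left = additive_uminus_diff[where f = "\<lambda>x. tensor_act x n" for n, OF tensor_act_add]
lemmas tensor_act_right = additive_uminus_diff[where f = "tensor_act x" for x, OF tensor_act_add_right]

lemma tensor_act_word: "tensor_act (frag_of w) n = foldr F w n"
  unfolding tensor_act_def by (subst pm_sum_single) (simp_all add: int_scale_def)

text \<open>Both sides are biadditive, so words suffice, and on words concatenation becomes
  composition of operators.\<close>

lemma tensor_act_mult: "tensor_act (x * y) n = tensor_act x (tensor_act y n)"
proof -
  have "Poly_Mapping.keys x \<subseteq> UNIV" by simp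
  then show ?thesis
  proof (induction x rule: frag_induction)
    case (one v)
    have "Poly_Mapping.keys y \<subseteq> UNIV" by simp
    then show ?case
    proof (induction y rule: frag_induction)
      case (one w)
      have "frag_of v * frag_of w = frag_of (v @ w)"
        by (simp add: mult_single plus_list_def)
      then show ?case by (simp add: tensor_act_word)
    qed (simp_all add: tensor_act_left tensor_act_right right_diff_distrib)
  qed (simp_all add: tensor_act_left left_diff_distrib)
qed

lemma tensor_act_anticommute:
  assumes "x \<in> tensor_M" "y \<in> tensor_M"
  shows "tensor_act x (tensor_act y n) = - tensor_act y (tensor_act x n)"
proof -
  have "Poly_Mapping.keys x \<subseteq> {w. length w = 1}" using assms by (auto simp: tensor_M_def)
  then show ?thesis
  proof (induction x rule: frag_induction)
    case (one v)
    have "Poly_Mapping.keys y \<subseteq> {w. length w = 1}" using assms by (auto simp: tensor_M_def)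
    then show ?case
    proof (induction y rule: frag_induction)
      case (one w)
      obtain i j where "v = [i]" "w = [j]"
        using one \<open>v \<in> _\<close> by (auto simp: length_Suc_conv)
      then show ?case by (simp add: tensor_act_word) (rule F_anticommute)
    qed (simp_all add: tensor_act_left tensor_act_right)
  qed (simp_all add: tensor_act_left tensor_act_right)
qed

text \<open>Polarisation: the cross terms in the square of \<open>a - b\<close> cancel by
  anticommutation. For single letters \<open>F_square\<close> is used, as anticommutation alone
  controls only twice the square.\<close>

lemma tensor_act_square:
  assumes "x \<in> tensor_M"
  shows "tensor_act x (tensor_act x n) = 0"
proof -
  have "Poly_Mapping.keys x \<subseteq> {w. length w = 1}" using assms by (auto simp: tensor_M_def)
  \<comment> \<open>Membership in \<open>tensor_M\<close> is carried along because the difference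
    case applies anticommutation to \<open>a\<close> and \<open>b\<close>.\<close>
  then have "x \<in> tensor_M \<and> tensor_act x (tensor_act x n) = 0"
  proof (induction x rule: frag_induction)
    case zero
    show ?case by (simp add: tensor_act_left tensor_M_def)
  next
    case (one w)
    then obtain i where "w = [i]" by (auto simp: length_Suc_conv)
    then show ?case by (simp add: tensor_act_word F_square tensor_M_def)
  next
    case (diff a b)
    have "a - b \<in> tensor_M"
      using diff keys_diff[of a b] by (auto simp: tensor_M_def)
    with diff tensor_act_anticommute[of a b n] show ?case
      by (simp add: tensor_act_left tensor_act_right)
  qed
  then show ?thesis ..
qed

text \<open>The vector \<open>n\<close> has to vary: for a right multiple \<open>x * a\<close>, the
  vanishing of \<open>x\<close> is applied at \<open>tensor_act a n\<close>.\<close>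

lemma tensor_act_ideal: "x \<in> ext_ideal \<Longrightarrow> tensor_act x n = 0"
  by (induction x arbitrary: n rule: ext_ideal.induct)
    (simp_all add: tensor_act_mult tensor_act_square tensor_act_left tensor_act_right tensor_act_add)

definition ext_act :: "ext \<Rightarrow> 'n \<Rightarrow> 'n" where
  "ext_act u = tensor_act (rep_ext u)"

lemma ext_act_abs: "ext_act (abs_ext x) n = tensor_act x n"
proof -
  have "ext_rel (rep_ext (abs_ext x)) x"
    by (rule Quotient3_rep_abs[OF Quotient3_ext]) (simp add: ext_rel_def ext_ideal.zero)
  then have "rep_ext (abs_ext x) - x \<in> ext_ideal" by (simp add: ext_rel_def)
  then have "tensor_act (rep_ext (abs_ext x) - x) n = 0" by (rule tensor_act_ideal)
  then show ?thesis by (simp add: ext_act_def tensor_act_left)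
qed

lemma ext_act_add: "ext_act (u + v) n = ext_act u n + ext_act v n"
proof (induction u rule: ext.abs_induct)
  case (1 x)
  show ?case
    by (induction v rule: ext.abs_induct) (simp add: plus_ext.abs_eq ext_act_abs tensor_act_add)
qed

lemma ext_act_mult: "ext_act (u * v) n = ext_act u (ext_act v n)"
proof (induction u rule: ext.abs_induct)
  case (1 x)
  show ?case
    by (induction v rule: ext.abs_induct) (simp add: times_ext.abs_eq ext_act_abs tensor_act_mult)
qed

lemma ext_act_add_right: "ext_act u (m + n) = ext_act u m + ext_act u n"
  by (simp add: ext_act_def tensor_act_add_right)

lemma ext_act_one: "ext_act 1 n = n"
proof -
  have "(1::tensor) = Poly_Mapping.single [] 1" by (simp flip: single_one add: zero_list_def)
  then have "tensor_act 1 n = n" using tensor_act_word[of "[]" n] by simp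
  then show ?thesis by (simp add: one_ext_def ext_act_abs)
qed

lemma ext_act_bvec: "ext_act (bvec i) n = F i n"
  by (simp add: bvec_def ext_act_abs tensor_act_word)

end

section \<open>Universal property of the Fock space\<close>

locale fock_target =
  fixes act :: "ext \<Rightarrow> 'n::ab_group_add \<Rightarrow> 'n" and v :: "int \<Rightarrow> 'n"
  assumes act_add: "act (u + u') x = act u x + act u' x"
    and act_add_right: "act u (x + y) = act u x + act u y"
    and act_mult: "act (u * u') x = act u (act u' x)"
    and act_one: "act 1 x = x"
    and absorb: "act (bvec m) (v (m - 1)) = v m"
    and kill: "act (bvec m) (v m) = 0"
begin

lemmas act_left = additive_uminus_diff[where f = "\<lambda>u. act u x" for x, OF act_add]
lemmas act_right = additive_uminus_diff[where f = "act u" for u, OF act_add_right]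

definition prefock_lift :: "prefock \<Rightarrow> 'n" where
  "prefock_lift = pm_sum (\<lambda>m u. act u (v m))"

lemma prefock_lift_add: "prefock_lift (x + y) = prefock_lift x + prefock_lift y"
  unfolding prefock_lift_def by (rule pm_sum_add) (simp_all add: act_add act_left)

lemmas prefock_lift_additive = additive_uminus_diff[where f = prefock_lift, OF prefock_lift_add]

lemma prefock_lift_single: "prefock_lift (Poly_Mapping.single m u) = act u (v m)"
  unfolding prefock_lift_def by (subst pm_sum_single) (simp_all add: act_left)

lemma prefock_lift_act: "prefock_lift (prefock_act u x) = act u (prefock_lift x)"
proof -
  interpret a: additive "act u" by standard (rule act_add_right)
  \<comment> \<open>Multiplication by \<open>u\<close> can kill coefficients and shrink the support,
    so the sums are compared over the support of \<open>x\<close>.\<close>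
  have "Poly_Mapping.keys (prefock_act u x) \<subseteq> Poly_Mapping.keys x"
    by (auto simp: in_keys_iff)
  then have "prefock_lift (prefock_act u x)
      = (\<Sum>m\<in>Poly_Mapping.keys x. act (u * Poly_Mapping.lookup x m) (v m))"
    unfolding prefock_lift_def by (subst pm_sum_superset) (auto simp: act_left)
  then show ?thesis by (simp add: prefock_lift_def pm_sum_def a.sum act_mult)
qed

text \<open>\<open>absorb\<close> and \<open>kill\<close> make the two families of generators
  vanish, and equivariance extends this to the submodule.\<close>

lemma prefock_lift_W: "x \<in> fock_W \<Longrightarrow> prefock_lift x = 0"
  by (induction rule: fock_W.induct)
    (simp_all add: prefock_lift_additive prefock_lift_add prefock_lift_single prefock_lift_act
      act_right act_one absorb kill)

definition fock_lift :: "fock \<Rightarrow> 'n" where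
  "fock_lift \<phi> = prefock_lift (rep_fock \<phi>)"

lemma fock_lift_abs: "fock_lift (abs_fock x) = prefock_lift x"
proof -
  have "fock_rel (rep_fock (abs_fock x)) x"
    by (rule Quotient3_rep_abs[OF Quotient3_fock]) (simp add: fock_rel_def fock_W.zero)
  then have "prefock_lift (rep_fock (abs_fock x) - x) = 0"
    by (simp add: fock_rel_def prefock_lift_W)
  then show ?thesis by (simp add: fock_lift_def prefock_lift_additive)
qed

lemma fock_lift_add: "fock_lift (\<phi> + \<psi>) = fock_lift \<phi> + fock_lift \<psi>"
proof (induction \<phi> rule: fock.abs_induct)
  case (1 x)
  show ?case
    by (induction \<psi> rule: fock.abs_induct) (simp add: plus_fock.abs_eq fock_lift_abs prefock_lift_add)
qed

lemma fock_lift_wedge: "fock_lift (u \<and>\<^sub>F \<phi>) = act u (fock_lift \<phi>)"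
  by (induction \<phi> rule: fock.abs_induct) (simp add: wedge.abs_eq fock_lift_abs prefock_lift_act)

lemma fock_lift_vac: "fock_lift (vac m) = v m"
  by (simp add: vac_def fock_lift_abs prefock_lift_single act_one)

end

section \<open>Generation by the basis vectors\<close>

lemma bvec_square: "bvec i * bvec i = 0"
  by transfer (auto simp: ext_rel_def tensor_M_def intro!: ext_ideal.square simp flip: mult_single)

text \<open>Polarisation of the square of \<open>bvec i + bvec j\<close>, which is itself the square
  of an element of \<open>M\<close>.\<close>

lemma bvec_anticommute: "bvec i * bvec j = - (bvec j * bvec i)"
proof -
  have "(bvec i + bvec j) * (bvec i + bvec j) = 0"
  proof transfer
    fix i j :: int
    have "frag_of [i] + frag_of [j] \<in> tensor_M"
      using Poly_Mapping.keys_add[of "frag_of [i]" "frag_of [j]"] by (auto simp: tensor_M_def)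
    then show "ext_rel ((frag_of [i] + frag_of [j]) * (frag_of [i] + frag_of [j])) 0"
      by (simp only: ext_rel_def diff_zero ext_ideal.square)
  qed
  then have "bvec i * bvec j + bvec j * bvec i = 0"
    by (simp add: algebra_simps bvec_square)
  then show ?thesis by (simp add: eq_neg_iff_add_eq_0)
qed

lemmas wedge_left = additive_uminus_diff[where f = "\<lambda>u. u \<and>\<^sub>F \<phi>" for \<phi>, OF wedge_add_left]
lemmas wedge_right = additive_uminus_diff[where f = "\<lambda>\<phi>. u \<and>\<^sub>F \<phi>" for u, OF wedge_add_right]

lemma bvec_wedge_square: "bvec i \<and>\<^sub>F bvec i \<and>\<^sub>F \<phi> = 0"
  by (simp add: wedge_wedge bvec_square wedge_left)

lemma bvec_wedge_anticommute: "bvec i \<and>\<^sub>F bvec j \<and>\<^sub>F \<phi> = - (bvec j \<and>\<^sub>F bvec i \<and>\<^sub>F \<phi>)"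
  by (subst (1 2) wedge_wedge) (simp add: wedge_left bvec_anticommute[of i j])

text \<open>Induction on \<open>m - i\<close>: split \<open>bvec m\<close> off the vacuum and move
  \<open>bvec i\<close> past it to the next lower vacuum.\<close>

lemma bvec_wedge_vac_eq_0:
  assumes "i \<le> m"
  shows "bvec i \<and>\<^sub>F vac m = 0"
proof -
  have "bvec (m - int k) \<and>\<^sub>F vac m = 0" for k
  proof (induction k arbitrary: m)
    case 0
    show ?case by (simp add: bvec_wedge_vac_same)
  next
    case (Suc k)
    have "bvec (m - int (Suc k)) \<and>\<^sub>F bvec m \<and>\<^sub>F vac (m - 1)
        = - (bvec m \<and>\<^sub>F bvec (m - 1 - int k) \<and>\<^sub>F vac (m - 1))"
      by (subst bvec_wedge_anticommute) (simp add: algebra_simps)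
    then show ?case by (simp add: bvec_wedge_vac Suc.IH wedge_right)
  qed
  from this[of "nat (m - i)"] assms show ?thesis by simp
qed

text \<open>Closure under differences alone provides zero (as \<open>1 - 1\<close>), negatives and
  sums, hence all integer combinations of words.\<close>

lemma ext_induct [case_names one diff bvec]:
  assumes "P 1" "\<And>u v. P u \<Longrightarrow> P v \<Longrightarrow> P (u - v)" "\<And>i u. P u \<Longrightarrow> P (bvec i * u)"
  shows "P u"
proof (induction u rule: ext.abs_induct)
  case (1 x)
  have "Poly_Mapping.keys x \<subseteq> UNIV" by simp
  then show ?case
  proof (induction x rule: frag_induction)
    case zero
    show ?case using assms(2)[OF assms(1) assms(1)] by (simp add: zero_ext_def)
  next
    case (one w)
    show ?case
    proof (induction w)
      case Nil
      show ?case using assms(1) by (simp add: one_ext_def zero_list_def flip: single_one)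
    next
      case (Cons i w)
      have "abs_ext (frag_of (i # w)) = bvec i * abs_ext (frag_of w)"
        by (simp add: bvec_def times_ext.abs_eq mult_single plus_list_def)
      with assms(3)[OF Cons, of i] show ?case by simp
    qed
  next
    case (diff a b)
    with assms(2) show ?case by (simp flip: minus_ext.abs_eq)
  qed
qed

lemma fock_induct [case_names vac diff bvec]:
  assumes "\<And>m. P (vac m)" "\<And>\<phi> \<psi>. P \<phi> \<Longrightarrow> P \<psi> \<Longrightarrow> P (\<phi> - \<psi>)"
    "\<And>i \<phi>. P \<phi> \<Longrightarrow> P (bvec i \<and>\<^sub>F \<phi>)"
  shows "P \<phi>"
proof (induction \<phi> rule: fock.abs_induct)
  case (1 x)
  have P0: "P 0" using assms(2)[OF assms(1)[of 0] assms(1)[of 0]] by simp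
  have Padd: "P (\<phi> + \<psi>)" if "P \<phi>" "P \<psi>" for \<phi> \<psi>
    using assms(2)[OF that(1) assms(2)[OF P0 that(2)]] by simp
  have Pvac: "P (u \<and>\<^sub>F vac m)" for u m
    by (induction u rule: ext_induct) (use assms in \<open>simp_all add: wedge_left flip: wedge_wedge\<close>)
  show ?case
  proof (induction x rule: update_induct)
    case const
    show ?case using P0 by (simp add: zero_fock_def)
  next
    case (update f a b)
    have "Poly_Mapping.update a b f = f + Poly_Mapping.single a b"
      by (rule poly_mapping_eqI)
        (use update in \<open>auto simp: lookup_update lookup_add lookup_single in_keys_iff when_def\<close>)
    then have "abs_fock (Poly_Mapping.update a b f) = abs_fock f + b \<and>\<^sub>F vac a"
      by (simp add: plus_fock.abs_eq vac_def wedge.abs_eq prefock_act_single)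
    then show ?case using Padd update Pvac by simp
  qed
qed

section \<open>Straightening of words and spanning by partitions\<close>

definition bword :: "int list \<Rightarrow> ext" where
  "bword w = prod_list (map bvec w)"

lemma bword_simps [simp]: "bword [] = 1" "bword (i # w) = bvec i * bword w"
  "bword (v @ w) = bword v * bword w"
  by (simp_all add: bword_def)

text \<open>Insertion into a decreasing word: each transposition costs a sign and a repeated letter
  gives zero. The set of letters is recorded so that lower bounds on them survive.\<close>

lemma bvec_mult_bword_sorted:
  assumes "sorted_wrt (>) w"
  shows "bvec i * bword w = 0 \<or>
    (\<exists>w'. sorted_wrt (>) w' \<and> set w' = insert i (set w) \<and> bvec i * bword w \<in> {bword w', - bword w'})"
  using assms
proof (induction w)
  case Nil
  show ?case by (intro disjI2 exI[of _ "[i]"]) simp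
next
  case (Cons a w)
  consider "i > a" | "i = a" | "i < a" by linarith
  then show ?case
  proof cases
    case 1
    then show ?thesis using Cons.prems by (intro disjI2 exI[of _ "i # a # w"]) auto
  next
    case 2
    then show ?thesis by (simp add: bvec_square flip: mult.assoc)
  next
    case 3
    have swap: "bvec i * bword (a # w) = - (bvec a * (bvec i * bword w))"
      using bvec_anticommute[of i a] by (simp flip: mult.assoc)
    from Cons consider "bvec i * bword w = 0"
      | w' where "sorted_wrt (>) w'" "set w' = insert i (set w)" "bvec i * bword w \<in> {bword w', - bword w'}"
      by auto
    then show ?thesis
    proof cases
      case 1
      then show ?thesis by (simp only: swap) simp
    next
      case 2
      have "sorted_wrt (>) (a # w')" using 2 3 Cons.prems by auto
      moreover have "set (a # w') = insert i (set (a # w))" using 2 by auto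
      moreover have "bvec i * bword (a # w) \<in> {bword (a # w'), - bword (a # w')}"
        unfolding swap using 2(3) by auto
      ultimately show ?thesis by blast
    qed
  qed
qed

lemma bword_wedge_vac_normal_form:
  "bword w \<and>\<^sub>F vac m = 0 \<or>
    (\<exists>w'. sorted_wrt (>) w' \<and> (\<forall>i\<in>set w'. m < i) \<and>
       bword w \<and>\<^sub>F vac m \<in> {bword w' \<and>\<^sub>F vac m, - (bword w' \<and>\<^sub>F vac m)})"
proof (induction w)
  case Nil
  show ?case by (intro disjI2 exI[of _ "[]"]) simp
next
  case (Cons i w)
  have eq: "bword (i # w) \<and>\<^sub>F vac m = bvec i \<and>\<^sub>F bword w \<and>\<^sub>F vac m"
    by (simp add: wedge_wedge)
  from Cons consider "bword w \<and>\<^sub>F vac m = 0"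
    | v where "sorted_wrt (>) v" "\<forall>i\<in>set v. m < i"
        "bword w \<and>\<^sub>F vac m \<in> {bword v \<and>\<^sub>F vac m, - (bword v \<and>\<^sub>F vac m)}"
    by blast
  then show ?case
  proof cases
    case 1
    then show ?thesis by (simp only: eq) (simp add: wedge_right)
  next
    case 2
    have step: "bword (i # w) \<and>\<^sub>F vac m \<in> {(bvec i * bword v) \<and>\<^sub>F vac m, - ((bvec i * bword v) \<and>\<^sub>F vac m)}"
      unfolding eq using 2(3) by (auto simp: wedge_right simp flip: wedge_wedge)
    show ?thesis
    proof (cases "m < i")
      case True
      from bvec_mult_bword_sorted[OF 2(1), of i] show ?thesis
      proof
        assume "bvec i * bword v = 0"
        then show ?thesis using step by (simp add: wedge_left)
      next
        assume "\<exists>w'. sorted_wrt (>) w' \<and> set w' = insert i (set v) \<and> bvec i * bword v \<in> {bword w', - bword w'}"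
        then obtain w' where w': "sorted_wrt (>) w'" "set w' = insert i (set v)"
          "bvec i * bword v \<in> {bword w', - bword w'}" by blast
        have "bword (i # w) \<and>\<^sub>F vac m \<in> {bword w' \<and>\<^sub>F vac m, - (bword w' \<and>\<^sub>F vac m)}"
          using step w'(3) by (auto simp: wedge_left)
        moreover have "\<forall>j\<in>set w'. m < j" using w'(2) 2(2) True by simp
        ultimately show ?thesis using w'(1) by blast
      qed
    next
      case False
      \<comment> \<open>A letter at most \<open>m\<close> travels through any word, up to sign,
        until it meets the vacuum and kills it.\<close>
      have "bvec i \<and>\<^sub>F bword u \<and>\<^sub>F vac m = 0" for u
      proof (induction u)
        case Nil
        show ?case using False by (simp add: bvec_wedge_vac_eq_0)
      next
        case (Cons j u)
        have "bvec i \<and>\<^sub>F bword (j # u) \<and>\<^sub>F vac m = - (bvec j \<and>\<^sub>F bvec i \<and>\<^sub>F bword u \<and>\<^sub>F vac m)"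
          by (subst bvec_wedge_anticommute[symmetric]) (simp flip: wedge_wedge)
        then show ?case by (simp add: Cons wedge_right)
      qed
      then have "(bvec i * bword v) \<and>\<^sub>F vac m = 0" by (simp flip: wedge_wedge)
      then show ?thesis using step by simp
    qed
  qed
qed

text \<open>From position \<open>k\<close> on there are \<open>length w - k\<close> distinct
  integers above \<open>m\<close>, and \<open>w ! k\<close> is the largest of them.\<close>

lemma bword_sorted_nth_ge:
  assumes "sorted_wrt (>) w" "\<forall>i\<in>set w. m < i" "k < length w"
  shows "w ! k \<ge> m + int (length w) - int k"
  using assms
proof (induction w arbitrary: k)
  case (Cons a w)
  show ?case
  proof (cases k)
    case 0
    show ?thesis
    proof (cases "w = []")
      case False
      then have "m + int (length w) \<le> w ! 0" using Cons.IH[of 0] Cons.prems by simp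
      moreover have "w ! 0 < a" using Cons.prems False by simp
      ultimately show ?thesis using 0 by simp
    qed (use Cons.prems 0 in simp)
  next
    case (Suc k')
    then show ?thesis using Cons.IH[of k'] Cons.prems by simp
  qed
qed simp

lemma bword_sorted_wedge_vac:
  assumes "sorted_wrt (>) w" "\<forall>i\<in>set w. m < i"
  shows "\<exists>l\<in>partitions. bword w \<and>\<^sub>F vac m = fbasis (m + int (length w)) l"
proof -
  define r where "r = length w"
  \<comment> \<open>The part is the excess of the letter over the vacuum letter
    \<open>m + r - i\<close>. It is nonnegative by \<open>bword_sorted_nth_ge\<close>, so
    \<open>nat\<close> loses nothing.\<close>
  define l where "l i = (if i < r then nat (w ! i - m - int r + int i) else 0)" for i
  have nth: "bvec (m + int r - int i + int (l i)) = bvec (w ! i)" if "i < r" for i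
    using bword_sorted_nth_ge[OF assms, of i] that by (simp add: l_def r_def)
  have "{i. l i \<noteq> 0} \<subseteq> {..<r}" by (auto simp: l_def)
  then have fin: "finite {i. l i \<noteq> 0}" and len: "plen l \<le> r"
    using finite_subset card_mono[of "{..<r}"] by (auto simp: plen_def)
  have "decseq l"
  proof (rule decseq_SucI)
    fix i
    have "w ! Suc i < w ! i" if "Suc i < r"
      using assms(1) that by (simp add: sorted_wrt_iff_nth_less r_def)
    then show "l (Suc i) \<le> l i" by (auto simp: l_def)
  qed
  with fin have l: "l \<in> partitions" by (simp add: partitions_def)
  have "bwedge r (m + int r) l = bword w"
    unfolding bwedge_def bword_def
    by (rule arg_cong[where f = prod_list], rule nth_equalityI)
      (use nth in \<open>simp_all add: r_def\<close>)
  then have "bword w \<and>\<^sub>F vac m = fbasis (m + int r) l"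
    using fbasis_eq[OF l len, of "m + int r"] by simp
  with l show ?thesis by (auto simp: r_def)
qed

text \<open>The spanning statement, phrased as an induction rule: it identifies additive operators
  that agree on all \<open>fbasis m l\<close>.\<close>

lemma fock_basis_induct:
  assumes basis: "\<And>m l. l \<in> partitions \<Longrightarrow> P (fbasis m l)"
    and diff: "\<And>\<phi> \<psi>. P \<phi> \<Longrightarrow> P \<psi> \<Longrightarrow> P (\<phi> - \<psi>)"
  shows "P \<phi>"
proof -
  have "(\<lambda>_. 0) \<in> partitions" by (simp add: partitions_def decseq_def)
  then have "P 0" using diff[OF basis basis] by (metis diff_self)
  then have uminus: "P (- \<psi>)" if "P \<psi>" for \<psi>
    using diff[of 0 \<psi>] that by simp
  \<comment> \<open>A prefix word makes the induction go through: a new \<open>bvec i\<close> is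
    absorbed at the right end of \<open>w\<close>.\<close>
  have "P (bword w \<and>\<^sub>F \<phi>)" for w
  proof (induction \<phi> arbitrary: w rule: fock_induct)
    case (vac m)
    from bword_wedge_vac_normal_form[of w m] show ?case
    proof
      assume "bword w \<and>\<^sub>F vac m = 0"
      with \<open>P 0\<close> show ?thesis by simp
    next
      assume "\<exists>w'. sorted_wrt (>) w' \<and> (\<forall>i\<in>set w'. m < i) \<and>
       bword w \<and>\<^sub>F vac m \<in> {bword w' \<and>\<^sub>F vac m, - (bword w' \<and>\<^sub>F vac m)}"
      then obtain w' where w': "sorted_wrt (>) w'" "\<forall>i\<in>set w'. m < i"
        "bword w \<and>\<^sub>F vac m \<in> {bword w' \<and>\<^sub>F vac m, - (bword w' \<and>\<^sub>F vac m)}" by blast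
      from bword_sorted_wedge_vac[OF w'(1,2)] basis have "P (bword w' \<and>\<^sub>F vac m)" by auto
      with w'(3) uminus show ?thesis by auto
    qed
  next
    case (diff \<phi> \<psi>)
    then show ?case using assms(2) by (simp add: wedge_right)
  next
    case (bvec i \<phi>)
    then show ?case using bvec[of "w @ [i]"] by (simp add: wedge_wedge)
  qed
  from this[of "[]"] show ?thesis by simp
qed

section \<open>Derivations and their extensions\<close>

lemma fps_anticommute:
  fixes f g :: "'a::ring fps"
  assumes "\<And>i j. fps_nth f i * fps_nth g j = - (fps_nth g j * fps_nth f i)"
  shows "f * g = - (g * f)"
proof (rule fps_ext)
  fix n
  have "fps_nth (f * g) n = (\<Sum>i=0..n. - (fps_nth g (n - i) * fps_nth f i))"
    using assms by (simp add: fps_mult_nth)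
  also have "\<dots> = (\<Sum>i=0..n. - (fps_nth g i * fps_nth f (n - i)))"
    by (rule sum.reindex_bij_witness[where i = "(-) n" and j = "(-) n"]) auto
  also have "\<dots> = fps_nth (- (g * f)) n"
    by (simp add: fps_mult_nth sum_negf)
  finally show "fps_nth (f * g) n = fps_nth (- (g * f)) n" .
qed

text \<open>Writing \<open>f = c + X g\<close>, the square of \<open>f\<close> is \<open>X\<^sup>2\<close> times the square of \<open>g\<close>, so all its
  coefficients vanish; this avoids dividing by two.\<close>

lemma fps_square_zero:
  fixes f :: "'a::ring_1 fps"
  assumes "\<And>i. fps_nth f i * fps_nth f i = 0"
    and "\<And>i j. fps_nth f i * fps_nth f j = - (fps_nth f j * fps_nth f i)"
  shows "f * f = 0"
proof (rule fps_ext)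
  fix n
  show "fps_nth (f * f) n = fps_nth 0 n"
    using assms
  proof (induction n arbitrary: f rule: less_induct)
    case (less n)
    define c g where "c = fps_const (fps_nth f 0)" and "g = fps_shift 1 f"
    have f: "f = c + fps_X * g"
      by (rule fps_ext) (auto simp: c_def g_def)
    have "c * c = 0" using less.prems(1)[of 0] by (simp add: c_def)
    have "g * c = - (c * g)"
      by (rule fps_anticommute) (use less.prems(2)[of _ 0] in \<open>simp add: c_def g_def\<close>)
    have X: "h * (fps_X * g) = fps_X * (h * g)" for h :: "'a fps"
      by (metis fps_mult_fps_X_commute mult.assoc)
    have "f * f = c * c + fps_X * (g * c + c * g) + fps_X * (fps_X * (g * g))"
      by (simp add: f distrib_left distrib_right X mult.assoc)
    then have "f * f = fps_X * (fps_X * (g * g))"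
      by (simp add: \<open>c * c = 0\<close> \<open>g * c = - (c * g)\<close>)
    moreover have "fps_nth (g * g) (n - 2) = fps_nth 0 (n - 2)" if "n \<ge> 2"
    proof (rule less.IH)
      show "fps_nth g i * fps_nth g i = 0" for i
        unfolding g_def fps_shift_nth by (rule less.prems)
      show "fps_nth g i * fps_nth g j = - (fps_nth g j * fps_nth g i)" for i j
        unfolding g_def fps_shift_nth by (rule less.prems)
    qed (use that in simp)
    ultimately show ?case by (auto simp: numeral_2_eq_2)
  qed
qed

lemma wedge_fps_nth: "fps_nth (wedge_fps f x) n = (\<Sum>i=0..n. fps_nth f i \<and>\<^sub>F fps_nth x (n - i))"
  by (simp add: wedge_fps_def atLeast0AtMost)

lemma wedge_fps_add: "wedge_fps (f + g) x = wedge_fps f x + wedge_fps g x"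
  by (rule fps_ext) (simp add: wedge_fps_nth wedge_add_left sum.distrib)

lemma wedge_fps_add_right: "wedge_fps f (x + y) = wedge_fps f x + wedge_fps f y"
  by (rule fps_ext) (simp add: wedge_fps_nth wedge_add_right sum.distrib)

lemmas wedge_fps_left = additive_uminus_diff[where f = "\<lambda>f. wedge_fps f x" for x, OF wedge_fps_add]

lemma wedge_fps_mult: "wedge_fps (f * g) x = wedge_fps f (wedge_fps g x)"
proof (rule fps_ext)
  fix n
  have left: "(\<Sum>i\<in>A. h i) \<and>\<^sub>F \<phi> = (\<Sum>i\<in>A. h i \<and>\<^sub>F \<phi>)" for A :: "nat set" and h \<phi>
    by (induction A rule: infinite_finite_induct) (simp_all add: wedge_left wedge_add_left)
  have right: "u \<and>\<^sub>F (\<Sum>i\<in>A. h i) = (\<Sum>i\<in>A. u \<and>\<^sub>F h i)" for A :: "nat set" and h u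
    by (induction A rule: infinite_finite_induct) (simp_all add: wedge_right wedge_add_right)
  \<comment> \<open>Both sides sum over triples of indices with total \<open>n\<close>, grouped
    differently.\<close>
  show "fps_nth (wedge_fps (f * g) x) n = fps_nth (wedge_fps f (wedge_fps g x)) n"
    using fps_mult_assoc_lemma[where k = n and n = n and
        f = "\<lambda>i j k. fps_nth f i \<and>\<^sub>F fps_nth g j \<and>\<^sub>F fps_nth x k"]
    by (simp add: wedge_fps_nth fps_mult_nth left right wedge_wedge)
qed

lemma wedge_fps_const_nth: "fps_nth (wedge_fps f (fps_const \<phi>)) n = fps_nth f n \<and>\<^sub>F \<phi>"
proof -
  have "fps_nth (wedge_fps f (fps_const \<phi>)) n = (\<Sum>i\<in>{n}. fps_nth f i \<and>\<^sub>F \<phi>)"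
    unfolding wedge_fps_nth by (rule sum.mono_neutral_cong_right) (auto simp: wedge_right)
  then show ?thesis by simp
qed

lemma wedge_fps_one: "wedge_fps 1 x = x"
proof (rule fps_ext)
  fix n
  have "fps_nth (wedge_fps 1 x) n = (\<Sum>i\<in>{0}. fps_nth x (n - i))"
    unfolding wedge_fps_nth by (rule sum.mono_neutral_cong_right) (auto simp: wedge_left)
  then show "fps_nth (wedge_fps 1 x) n = fps_nth x n" by simp
qed

text \<open>Let every \<open>b\<^sub>j\<close> act on the dual numbers \<open>\<int>[\<epsilon>]\<close> as multiplication by \<open>\<epsilon>\<close>. Since \<open>f b\<^sub>j = 0\<close>,
  the augmentation of \<open>f\<close> vanishes, and \<open>f u\<close> is \<open>f\<close> times the augmentation of \<open>u\<close>;
  hence \<open>f = f f = 0\<close>.\<close>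

lemma annihilating_idempotent_eq_0:
  fixes f :: ext
  assumes "f * f = f" and "\<And>j. f * bvec j = 0"
  shows "f = 0"
proof -
  interpret odd_operators "\<lambda>_ p. (0::int, fst p :: int)"
    by standard (simp_all add: zero_prod_def)
  have "\<exists>k. f * u = of_int k * f \<and> ext_act u (0, 1) = (0, k)" for u
  proof (induction u rule: ext_induct)
    case one
    show ?case by (intro exI[of _ 1]) (simp add: ext_act_one)
  next
    case (diff u v)
    then obtain k l where "f * u = of_int k * f" "ext_act u (0, 1) = (0, k)"
      "f * v = of_int l * f" "ext_act v (0, 1) = (0, l)" by blast
    then show ?case
      by (intro exI[of _ "k - l"])
        (simp add: additive_uminus_diff(3)[where f = "\<lambda>u. ext_act u x" for x, OF ext_act_add]
          algebra_simps)
  next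
    case (bvec i u)
    then show ?case
      by (intro exI[of _ 0]) (auto simp: ext_act_mult ext_act_bvec assms(2) simp flip: mult.assoc)
  qed
  then obtain k where k: "f * f = of_int k * f" "ext_act f (0, 1) = (0, k)" by blast
  have "ext_act f (0, 1) = ext_act (f * bvec 0) (1, 0)"
    by (simp add: ext_act_mult ext_act_bvec)
  also have "\<dots> = 0"
    using additive_uminus_diff(1)[where f = "\<lambda>u. ext_act u (1, 0)", OF ext_act_add]
    by (simp add: assms(2))
  finally show ?thesis using k assms(1) by (simp add: zero_prod_def)
qed

text \<open>In the convolution for coefficient \<open>n\<close>, the left factor vanishes by
  induction when \<open>i < n\<close>; the last term contains the zero constant coefficient.\<close>

lemma fps_idempotent_eq_0:
  fixes f :: "'a::ring_1 fps"
  assumes "f * f = f" and "fps_nth f 0 = 0"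
  shows "f = 0"
proof (rule fps_ext)
  fix n
  show "fps_nth f n = fps_nth 0 n"
  proof (induction n rule: less_induct)
    case (less n)
    have "fps_nth f n = (\<Sum>i=0..n. fps_nth f i * fps_nth f (n - i))"
      by (subst assms(1)[symmetric]) (simp add: fps_mult_nth)
    also have "\<dots> = 0"
    proof (rule sum.neutral, rule ballI)
      fix i assume "i \<in> {0..n}"
      then show "fps_nth f i * fps_nth f (n - i) = 0"
        using less assms(2) by (cases "i < n") auto
    qed
    finally show ?case by simp
  qed
qed

section \<open>Existence and uniqueness of Hasse-Schmidt derivations\<close>

lemma HS_derivation_one:
  assumes "HS_derivation D" and "\<And>j. fps_nth (D (bvec j)) 0 = bvec j"
  shows "D 1 = 1"
proof -
  have mult: "D (u * v) = D u * D v" for u v using assms(1) by (simp add: HS_derivation_def)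
  \<comment> \<open>\<open>f\<close> is an idempotent killing every \<open>D (bvec j)\<close>.
    Constant coefficients turn this into the situation of
    \<open>annihilating_idempotent_eq_0\<close>; the higher coefficients then vanish by
    \<open>fps_idempotent_eq_0\<close>.\<close>
  define f where "f = 1 - D 1"
  have idem: "f * f = f" using mult[of 1 1] by (simp add: f_def algebra_simps)
  have "f * D (bvec j) = 0" for j using mult[of 1 "bvec j"] by (simp add: f_def algebra_simps)
  then have "fps_nth (f * D (bvec j)) 0 = 0" for j by simp
  then have "fps_nth f 0 * bvec j = 0" for j by (simp add: assms(2))
  moreover have "fps_nth f 0 * fps_nth f 0 = fps_nth f 0"
    using arg_cong[OF idem, of "\<lambda>g. fps_nth g 0"] by simp
  ultimately have "fps_nth f 0 = 0" by (rule annihilating_idempotent_eq_0[rotated])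
  with idem have "f = 0" by (rule fps_idempotent_eq_0)
  then show ?thesis by (simp add: f_def)
qed

lemma HS_derivation_unique:
  assumes "HS_derivation D" "HS_derivation D'"
    and "\<And>j. fps_nth (D (bvec j)) 0 = bvec j" "\<And>j. D' (bvec j) = D (bvec j)"
  shows "D' = D"
proof
  fix u
  have add: "D (u + v) = D u + D v" "D' (u + v) = D' u + D' v"
    and mult: "D (u * v) = D u * D v" "D' (u * v) = D' u * D' v" for u v
    using assms(1,2) by (simp_all add: HS_derivation_def additive_def)
  have one: "D 1 = 1" "D' 1 = 1" by (rule HS_derivation_one; simp add: assms)+
  show "D' u = D u"
    by (induction u rule: ext_induct)
      (simp_all add: one mult assms(4) additive_uminus_diff(3)[where f = D, OF add(1)]
        additive_uminus_diff(3)[where f = D', OF add(2)])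
qed

text \<open>The exterior algebra acts on its power series by left multiplication with the
  \<open>S i\<close>, and \<open>D u\<close> is the result of \<open>u\<close> acting on
  \<open>1\<close>. The action commutes with right multiplication, so \<open>D\<close> is
  multiplicative.\<close>

lemma HS_derivation_exists:
  assumes "\<And>i. S i * S i = 0" "\<And>i j. S i * S j = - (S j * S i)"
  shows "\<exists>D. HS_derivation D \<and> (\<forall>j. D (bvec j) = S j)"
proof -
  interpret odd_operators "\<lambda>i x. S i * x"
  proof
    fix i j x
    show "S i * (S i * x) = 0" using assms(1)[of i] by (simp flip: mult.assoc)
    show "S i * (S j * x) = - (S j * (S i * x))"
      using assms(2)[of i j] by (simp flip: mult.assoc)
  qed (simp add: algebra_simps)
  have "ext_act u x = ext_act u 1 * x" for u x
    by (induction u rule: ext_induct)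
      (simp_all add: ext_act_one ext_act_mult ext_act_bvec algebra_simps
        additive_uminus_diff(3)[where f = "\<lambda>u. ext_act u x" for x, OF ext_act_add])
  then have "ext_act (u * v) 1 = ext_act u 1 * ext_act v 1" for u v
    by (metis ext_act_mult)
  then have "HS_derivation (\<lambda>u. ext_act u 1)"
    by (simp add: HS_derivation_def additive_def ext_act_add)
  then show ?thesis by (intro exI[of _ "\<lambda>u. ext_act u 1"]) (simp add: ext_act_bvec)
qed

lemma HS_derivation_the:
  assumes "\<And>i. S i * S i = 0" "\<And>i j. S i * S j = - (S j * S i)"
    and "\<And>j. fps_nth (S j) 0 = bvec j"
    and D: "D = (THE D. HS_derivation D \<and> (\<forall>j. D (bvec j) = S j))"
  shows "HS_derivation D" "D (bvec j) = S j" "D 1 = 1"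
proof -
  obtain D0 where D0: "HS_derivation D0" "\<forall>j. D0 (bvec j) = S j"
    using HS_derivation_exists[of S, OF assms(1,2)] by blast
  have "D = D0" unfolding D
    by (rule the_equality) (use D0 HS_derivation_unique assms(3) in auto)
  with D0 show *: "HS_derivation D" and "D (bvec j) = S j" for j by simp_all
  then show "D 1 = 1" using assms(3) by (simp add: HS_derivation_one)
qed

text \<open>Series over the Fock space become a module via \<open>D\<close>, and
  \<open>absorb\<close> and \<open>kill\<close> are the defining relations of the Fock space there.
  The third conclusion extends the prescribed rule from basis elements to all \<open>u\<close> and
  \<open>\<phi>\<close>.\<close>

lemma fock_extension:
  assumes D: "HS_derivation D" "D 1 = 1"
    and absorb: "\<And>m. wedge_fps (D (bvec m)) (v (m - 1)) = v m"
    and kill: "\<And>m. wedge_fps (D (bvec m)) (v m) = 0"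
  shows "fock_extension D v (\<phi> + \<psi>) = fock_extension D v \<phi> + fock_extension D v \<psi>"
    "fock_extension D v (vac m) = v m"
    "fock_extension D v (u \<and>\<^sub>F \<phi>) = wedge_fps (D u) (fock_extension D v \<phi>)"
proof -
  have D_add: "D (u + u') = D u + D u'" and D_mult: "D (u * u') = D u * D u'" for u u'
    using D by (simp_all add: HS_derivation_def additive_def)
  interpret fock_target "\<lambda>u. wedge_fps (D u)" v
    by standard (simp_all add: D_add D_mult D wedge_fps_add wedge_fps_add_right wedge_fps_mult
        wedge_fps_one absorb kill)
  have "fock_extension D v = fock_lift"
    unfolding fock_extension_def
  proof (rule the_equality)
    show "additive fock_lift \<and> (\<forall>m. fock_lift (vac m) = v m) \<and>
      (\<forall>m. \<forall>l\<in>partitions. \<forall>r\<ge>plen l.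
        fock_lift (fbasis m l) = wedge_fps (D (bwedge r m l)) (fock_lift (vac (m - int r))))"
    proof (intro conjI allI ballI impI)
      fix m l r
      assume "l \<in> partitions" "plen l \<le> r"
      then show "fock_lift (fbasis m l) = wedge_fps (D (bwedge r m l)) (fock_lift (vac (m - int r)))"
        by (subst fbasis_eq) (simp_all add: fock_lift_wedge)
    qed (simp_all add: additive_def fock_lift_add fock_lift_vac)
  next
    fix T
    assume T: "additive T \<and> (\<forall>m. T (vac m) = v m) \<and>
      (\<forall>m. \<forall>l\<in>partitions. \<forall>r\<ge>plen l.
        T (fbasis m l) = wedge_fps (D (bwedge r m l)) (T (vac (m - int r))))"
    then have T_diff: "T (\<phi> - \<psi>) = T \<phi> - T \<psi>" for \<phi> \<psi>
      by (simp add: additive.diff)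
    show "T = fock_lift"
    proof
      fix \<phi>
      show "T \<phi> = fock_lift \<phi>"
      proof (induction \<phi> rule: fock_basis_induct)
        case (1 m l)
        then have "T (fbasis m l) = wedge_fps (D (bwedge (plen l) m l)) (v (m - int (plen l)))"
          using T by (metis order_refl)
        then show ?case by (simp add: fbasis_def fock_lift_wedge fock_lift_vac)
      next
        case (2 \<phi> \<psi>)
        then show ?case
          by (simp add: T_diff additive_uminus_diff(3)[where f = fock_lift, OF fock_lift_add])
      qed
    qed
  qed
  then show "fock_extension D v (\<phi> + \<psi>) = fock_extension D v \<phi> + fock_extension D v \<psi>"
    "fock_extension D v (vac m) = v m"
    "fock_extension D v (u \<and>\<^sub>F \<phi>) = wedge_fps (D u) (fock_extension D v \<phi>)"
    by (simp_all add: fock_lift_add fock_lift_vac fock_lift_wedge)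
qed

section \<open>Coefficient rules for series\<close>

lemma series_simps:
  "series_pos (f + g) n = series_pos f n + series_pos g n"
  "series_neg (f + g) n = series_neg f n + series_neg g n"
  for f g :: "'a::monoid_add fps"
  by (simp_all add: series_pos_def series_neg_def)

lemma wedge_fps_const_left_nth: "fps_nth (wedge_fps (fps_const u) x) n = u \<and>\<^sub>F fps_nth x n"
proof -
  have "fps_nth (wedge_fps (fps_const u) x) n = (\<Sum>i\<in>{0}. u \<and>\<^sub>F fps_nth x (n - i))"
    unfolding wedge_fps_nth by (rule sum.mono_neutral_cong_right) (auto simp: wedge_left)
  then show ?thesis by simp
qed

lemma wedge_fps_X_nth:
  "fps_nth (wedge_fps fps_X x) n = (if n = 0 then 0 else fps_nth x (n - 1))"
proof -
  have "fps_nth (wedge_fps fps_X x) n = (\<Sum>i\<in>{0..n} \<inter> {1}. fps_nth x (n - i))"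
    unfolding wedge_fps_nth by (rule sum.mono_neutral_cong_right) (auto simp: wedge_left fps_X_def)
  then show ?thesis by (auto simp: Int_insert_right)
qed

section \<open>The operators on the Fock space\<close>

lemma sigma_plus:
  "HS_derivation sigma_plus" "sigma_plus (bvec j) = Abs_fps (\<lambda>i. bvec (j + int i))"
  "sigma_plus 1 = 1"
proof -
  let ?S = "\<lambda>j. Abs_fps (\<lambda>i. bvec (j + int i))"
  have 1: "?S i * ?S i = 0" for i
    by (rule fps_square_zero) (simp_all add: bvec_square, rule bvec_anticommute)
  have 2: "?S i * ?S j = - (?S j * ?S i)" for i j
    by (rule fps_anticommute) (simp, rule bvec_anticommute)
  note * = HS_derivation_the[of ?S, OF 1 2 _ sigma_plus_def]
  show "HS_derivation sigma_plus" "sigma_plus (bvec j) = ?S j" "sigma_plus 1 = 1"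
    by (rule *; simp)+
qed

lemma sigma_minus_bar:
  "HS_derivation sigma_minus_bar"
  "sigma_minus_bar (bvec j) = fps_const (bvec j) - fps_const (bvec (j - 1)) * fps_X"
  "sigma_minus_bar 1 = 1"
proof -
  let ?S = "\<lambda>j. fps_const (bvec j) - fps_const (bvec (j - 1)) * fps_X"
  have nth: "fps_nth (?S j) n = (if n = 0 then bvec j else if n = 1 then - bvec (j - 1) else 0)" for j n
    by simp
  have anti: "fps_nth (?S i) k * fps_nth (?S j) l = - (fps_nth (?S j) l * fps_nth (?S i) k)" for i j k l
    unfolding nth
    by (simp add: bvec_anticommute[of i j] bvec_anticommute[of i "j - 1"]
        bvec_anticommute[of "i - 1" j] bvec_anticommute[of "i - 1" "j - 1"])
  have "fps_nth (?S i) k * fps_nth (?S i) k = 0" for i k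
    unfolding nth by (simp add: bvec_square)
  then have 1: "?S i * ?S i = 0" for i
    using anti by (rule fps_square_zero)
  have 2: "?S i * ?S j = - (?S j * ?S i)" for i j
    by (rule fps_anticommute) (rule anti)
  note * = HS_derivation_the[of ?S, OF 1 2 _ sigma_minus_bar_def]
  show "HS_derivation sigma_minus_bar" "sigma_minus_bar (bvec j) = ?S j" "sigma_minus_bar 1 = 1"
    by (rule *; simp)+
qed

text \<open>Splitting off the first term of the series. This yields both the vacuum relation for
  \<open>sigma_plus_fock\<close> and the cancellation against
  \<open>sigma_minus_bar\<close>.\<close>

lemma sigma_plus_bvec_pred:
  "sigma_plus (bvec (j - 1)) = fps_const (bvec (j - 1)) + fps_X * sigma_plus (bvec j)"
  by (rule fps_ext) (auto simp: sigma_plus of_nat_diff algebra_simps)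

lemma sigma_plus_bvec_square: "sigma_plus (bvec j) * sigma_plus (bvec j) = 0"
  unfolding sigma_plus by (rule fps_square_zero) (simp_all add: bvec_square, rule bvec_anticommute)

lemma fps_const_wedge: "wedge_fps (fps_const u) (fps_const \<phi>) = fps_const (u \<and>\<^sub>F \<phi>)"
  by (rule fps_ext) (simp add: wedge_fps_const_left_nth wedge_right)

lemma sigma_plus_fock:
  "sigma_plus_fock (\<phi> + \<psi>) = sigma_plus_fock \<phi> + sigma_plus_fock \<psi>"
  "sigma_plus_fock (vac m) = wedge_fps (sigma_plus (bvec m)) (fps_const (vac (m - 1)))"
  "sigma_plus_fock (u \<and>\<^sub>F \<phi>) = wedge_fps (sigma_plus u) (sigma_plus_fock \<phi>)"
proof -
  let ?v = "\<lambda>m. wedge_fps (sigma_plus (bvec m)) (fps_const (vac (m - 1)))"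
  have "wedge_fps (sigma_plus (bvec m)) (?v m) = 0" for m
    by (simp add: wedge_fps_left sigma_plus_bvec_square flip: wedge_fps_mult)
  moreover have "wedge_fps (sigma_plus (bvec m)) (?v (m - 1)) = ?v m" for m
  proof -
    \<comment> \<open>Next to \<open>sigma_plus (bvec m)\<close> only the constant term of
      \<open>sigma_plus (bvec (m - 1))\<close> survives, since the remainder is a multiple of
      \<open>sigma_plus (bvec m)\<close>.\<close>
    have "sigma_plus (bvec m) * (fps_X * sigma_plus (bvec m)) = 0"
      by (metis fps_mult_fps_X_commute mult.assoc mult_zero_right sigma_plus_bvec_square)
    then have "sigma_plus (bvec m) * sigma_plus (bvec (m - 1)) = sigma_plus (bvec m) * fps_const (bvec (m - 1))"
      by (simp add: sigma_plus_bvec_pred distrib_left)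
    then have "wedge_fps (sigma_plus (bvec m)) (?v (m - 1))
        = wedge_fps (sigma_plus (bvec m)) (wedge_fps (fps_const (bvec (m - 1))) (fps_const (vac (m - 1 - 1))))"
      by (simp only: flip: wedge_fps_mult)
    then show ?thesis by (simp only: fps_const_wedge bvec_wedge_vac)
  qed
  ultimately show "sigma_plus_fock (\<phi> + \<psi>) = sigma_plus_fock \<phi> + sigma_plus_fock \<psi>"
    "sigma_plus_fock (vac m) = ?v m"
    "sigma_plus_fock (u \<and>\<^sub>F \<phi>) = wedge_fps (sigma_plus u) (sigma_plus_fock \<phi>)"
    unfolding sigma_plus_fock_def by (intro fock_extension sigma_plus; simp)+
qed

lemma wedge_sigma_minus_bar_nth:
  "fps_nth (wedge_fps (sigma_minus_bar (bvec j)) x) n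
    = bvec j \<and>\<^sub>F fps_nth x n - (if n = 0 then 0 else bvec (j - 1) \<and>\<^sub>F fps_nth x (n - 1))"
  by (simp add: sigma_minus_bar wedge_fps_left wedge_fps_mult wedge_fps_const_left_nth
      wedge_fps_X_nth wedge_right)

text \<open>The vacuum relations hold because the lowered vector \<open>bvec (m - 1)\<close> kills
  both \<open>vac m\<close> and \<open>vac (m - 1)\<close>.\<close>

lemma sigma_minus_bar_fock:
  "sigma_minus_bar_fock (\<phi> + \<psi>) = sigma_minus_bar_fock \<phi> + sigma_minus_bar_fock \<psi>"
  "sigma_minus_bar_fock (vac m) = fps_const (vac m)"
  "sigma_minus_bar_fock (u \<and>\<^sub>F \<phi>) = wedge_fps (sigma_minus_bar u) (sigma_minus_bar_fock \<phi>)"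
proof -
  have "wedge_fps (sigma_minus_bar (bvec m)) (fps_const (vac m)) = 0" for m
    by (rule fps_ext) (simp add: wedge_sigma_minus_bar_nth wedge_right bvec_wedge_vac_eq_0)
  moreover have "wedge_fps (sigma_minus_bar (bvec m)) (fps_const (vac (m - 1))) = fps_const (vac m)" for m
    by (rule fps_ext) (simp add: wedge_sigma_minus_bar_nth wedge_right bvec_wedge_vac bvec_wedge_vac_same)
  ultimately show "sigma_minus_bar_fock (\<phi> + \<psi>) = sigma_minus_bar_fock \<phi> + sigma_minus_bar_fock \<psi>"
    "sigma_minus_bar_fock (vac m) = fps_const (vac m)"
    "sigma_minus_bar_fock (u \<and>\<^sub>F \<phi>) = wedge_fps (sigma_minus_bar u) (sigma_minus_bar_fock \<phi>)"
    unfolding sigma_minus_bar_fock_def by (intro fock_extension sigma_minus_bar; simp)+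
qed

section \<open>The shift \<open>R(z)\<close>, which turns the wedge with \<open>b_i\<close> into
  \<open>z\<close> times the wedge with \<open>b_(i+1)\<close>\<close>

definition R_bvec :: "int \<Rightarrow> (int \<Rightarrow>\<^sub>0 fock) \<Rightarrow> (int \<Rightarrow>\<^sub>0 fock)" where
  "R_bvec i x = Poly_Mapping.map ((\<and>\<^sub>F) (bvec (i + 1))) (Poly_Mapping.map_key (\<lambda>n. n - 1) x)"

lemma lookup_R_bvec:
  "Poly_Mapping.lookup (R_bvec i x) n = bvec (i + 1) \<and>\<^sub>F Poly_Mapping.lookup x (n - 1)"
  by (simp add: R_bvec_def Poly_Mapping.map.rep_eq Poly_Mapping.map_key.rep_eq inj_def when_def wedge_right)

lemma R_bvec_single:
  "R_bvec i (Poly_Mapping.single n \<phi>) = Poly_Mapping.single (n + 1) (bvec (i + 1) \<and>\<^sub>F \<phi>)"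
  by (rule poly_mapping_eqI) (auto simp: lookup_R_bvec lookup_single when_def wedge_right)

text \<open>The operators \<open>R_bvec i\<close> and the images of the vacua satisfy the Fock space
  relations, so a lift exists; it has the prescribed values on the basis elements, and these
  span.\<close>

lemma R_fock:
  "R_fock (\<phi> + \<psi>) = R_fock \<phi> + R_fock \<psi>"
  "R_fock (vac m) = Poly_Mapping.single (m + 1) (vac (m + 1))"
  "R_fock (bvec i \<and>\<^sub>F \<phi>) = R_bvec i (R_fock \<phi>)"
proof -
  interpret odd_operators R_bvec
  proof
    show "R_bvec i (x + y) = R_bvec i x + R_bvec i y" for i x y
      by (rule poly_mapping_eqI) (simp add: lookup_R_bvec lookup_add wedge_add_right)
    show "R_bvec i (R_bvec i x) = 0" for i x
      by (rule poly_mapping_eqI) (simp add: lookup_R_bvec bvec_wedge_square)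
    show "R_bvec i (R_bvec j x) = - R_bvec j (R_bvec i x)" for i j x
      by (rule poly_mapping_eqI) (simp add: lookup_R_bvec, rule bvec_wedge_anticommute)
  qed
  interpret fock_target ext_act "\<lambda>m. Poly_Mapping.single (m + 1) (vac (m + 1))"
    using bvec_wedge_vac[of "m + 1" for m]
    by unfold_locales (simp_all add: ext_act_add ext_act_add_right ext_act_mult ext_act_one
        ext_act_bvec R_bvec_single bvec_wedge_vac_same)
  have word: "fock_lift (bword w \<and>\<^sub>F vac m) =
      Poly_Mapping.single (m + 1 + int (length w)) (bword (map (\<lambda>i. i + 1) w) \<and>\<^sub>F vac (m + 1))" for w m
    by (induction w)
      (simp_all add: fock_lift_vac fock_lift_wedge ext_act_bvec R_bvec_single algebra_simps flip: wedge_wedge)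
  have bwedge: "bwedge r m l = bword (map (\<lambda>i. m - int i + int (l i)) [0..<r])" for r m l
    by (simp add: bwedge_def bword_def comp_def)
  \<comment> \<open>The vacuum of charge \<open>m - plen l\<close> contributes exponent
    \<open>m - plen l + 1\<close> and each of the \<open>plen l\<close> letters one more, giving
    \<open>m + 1\<close>.\<close>
  have basis: "fock_lift (fbasis m l) = Poly_Mapping.single (m + 1) (fbasis (m + 1) l)" for m l
    unfolding fbasis_def bwedge word by (simp add: comp_def algebra_simps)
  have "R_fock = fock_lift"
    unfolding R_fock_def
  proof (rule the_equality)
    fix T
    assume T: "additive T \<and> (\<forall>m. \<forall>l\<in>partitions.
      T (fbasis m l) = Poly_Mapping.single (m + 1) (fbasis (m + 1) l))"
    then have T_diff: "T (\<phi> - \<psi>) = T \<phi> - T \<psi>" for \<phi> \<psi>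
      by (simp add: additive.diff)
    show "T = fock_lift"
    proof
      fix \<phi>
      show "T \<phi> = fock_lift \<phi>"
        by (induction \<phi> rule: fock_basis_induct)
          (use T basis in \<open>simp_all add: T_diff
            additive_uminus_diff(3)[where f = fock_lift, OF fock_lift_add]\<close>)
    qed
  qed (simp add: additive_def fock_lift_add basis)
  note R = this
  show "R_fock (\<phi> + \<psi>) = R_fock \<phi> + R_fock \<psi>"
    unfolding R by (rule fock_lift_add)
  show "R_fock (vac m) = Poly_Mapping.single (m + 1) (vac (m + 1))"
    unfolding R by (rule fock_lift_vac)
  show "R_fock (bvec i \<and>\<^sub>F \<phi>) = R_bvec i (R_fock \<phi>)"
    unfolding R fock_lift_wedge ext_act_bvec by (rule refl)
qed

section \<open>Two-sided series\<close>

lemma Sum_any_diff: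
  fixes f g :: "'a \<Rightarrow> 'b::ab_group_add"
  assumes "finite {a. f a \<noteq> 0}" "finite {a. g a \<noteq> 0}"
  shows "(\<Sum>a. f a - g a) = (\<Sum>a. f a) - (\<Sum>a. g a)"
proof -
  \<comment> \<open>Finiteness of both supports rules out the default value \<open>0\<close>, and
    all three sums can run over the union.\<close>
  let ?S = "{a. f a \<noteq> 0} \<union> {a. g a \<noteq> 0}"
  have "Sum_any h = sum h ?S" if "\<And>a. f a = 0 \<Longrightarrow> g a = 0 \<Longrightarrow> h a = 0" for h :: "'a \<Rightarrow> 'b"
    using assms that by (intro Sum_any.expand_superset) auto
  then show ?thesis by (simp add: sum_subtractf)
qed

lemma Sum_any_additive:
  fixes f :: "'a::ab_group_add \<Rightarrow> 'b::ab_group_add"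
  assumes add: "\<And>x y. f (x + y) = f x + f y" and fin: "finite {a. g a \<noteq> 0}"
  shows "f (\<Sum>a. g a) = (\<Sum>a. f (g a))"
proof -
  interpret additive f by standard (rule add)
  have "(\<Sum>a. f (g a)) = (\<Sum>a\<in>{a. g a \<noteq> 0}. f (g a))"
    using fin by (intro Sum_any.expand_superset) (auto simp: zero)
  then show ?thesis by (simp add: sum Sum_any.expand_set)
qed

lemma Sum_any_shift:
  fixes f :: "int \<Rightarrow> 'a::comm_monoid_add"
  shows "(\<Sum>k. f (k + 1)) = (\<Sum>k. f k)"
  by (rule Sum_any.reindex_cong[symmetric, where l = "\<lambda>k. k + 1"])
    (auto simp: comp_def intro!: bij_betw_byWitness[where f' = "\<lambda>k. k - 1"])

section \<open>Coefficients of the composite operator and finiteness of its sums\<close>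

abbreviation splus :: "fock \<Rightarrow> int \<Rightarrow> fock" where
  "splus \<phi> \<equiv> series_pos (sigma_plus_fock \<phi>)"

abbreviation sminus :: "fock \<Rightarrow> int \<Rightarrow> fock" where
  "sminus \<phi> \<equiv> series_neg (sigma_minus_bar_fock \<phi>)"

abbreviation rcoeff :: "fock \<Rightarrow> int \<Rightarrow> fock" where
  "rcoeff \<phi> \<equiv> Poly_Mapping.lookup (R_fock \<phi>)"

abbreviation sigma_sigma :: "fock \<Rightarrow> int \<Rightarrow> fock" where
  "sigma_sigma \<phi> \<equiv> sigma_plus_op (sminus \<phi>)"

lemma sigma_sigma_eq: "sigma_sigma \<phi> k = (\<Sum>l. splus (sminus \<phi> l) (k - l))"
  by (simp add: sigma_plus_op_def coeffwise_def)

lemma splus_add: "splus (\<phi> + \<psi>) n = splus \<phi> n + splus \<psi> n"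
  by (simp add: sigma_plus_fock series_simps)

lemmas splus_additive = additive_uminus_diff[where f = "\<lambda>\<phi>. splus \<phi> n" for n, OF splus_add]

lemma sminus_add: "sminus (\<phi> + \<psi>) n = sminus \<phi> n + sminus \<psi> n"
  by (simp add: sigma_minus_bar_fock series_simps)

lemmas sminus_additive = additive_uminus_diff[where f = "\<lambda>\<phi>. sminus \<phi> n" for n, OF sminus_add]

lemma rcoeff_add: "rcoeff (\<phi> + \<psi>) n = rcoeff \<phi> n + rcoeff \<psi> n"
  by (simp add: R_fock lookup_add)

lemmas rcoeff_additive = additive_uminus_diff[where f = "\<lambda>\<phi>. rcoeff \<phi> n" for n, OF rcoeff_add]

lemma splus_vac: "splus (vac m) n = (if 0 \<le> n then bvec (m + n) \<and>\<^sub>F vac (m - 1) else 0)"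
  by (simp add: series_pos_def sigma_plus_fock wedge_fps_const_nth sigma_plus)

lemma splus_bvec_pred:
  "splus (bvec (i - 1) \<and>\<^sub>F \<phi>) (n + 1) = bvec (i - 1) \<and>\<^sub>F splus \<phi> (n + 1) + splus (bvec i \<and>\<^sub>F \<phi>) n"
  by (cases "n + 1 = 0")
    (auto simp: series_pos_def sigma_plus_fock sigma_plus_bvec_pred wedge_fps_add wedge_fps_mult
      wedge_fps_const_left_nth wedge_fps_X_nth wedge_right nat_add_distrib)

lemma sminus_vac: "sminus (vac m) n = (if n = 0 then vac m else 0)"
  by (auto simp: series_neg_def sigma_minus_bar_fock)

text \<open>The factor inverse to \<open>z\<close> moves coefficient \<open>n + 1\<close> to
  \<open>n\<close>. At \<open>n = 0\<close> the second term vanishes because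
  \<open>series_neg\<close> is zero at positive indices.\<close>

lemma sminus_bvec: "sminus (bvec i \<and>\<^sub>F \<phi>) n = bvec i \<and>\<^sub>F sminus \<phi> n - bvec (i - 1) \<and>\<^sub>F sminus \<phi> (n + 1)"
proof (cases "n < 0")
  case True
  then have "nat (- n) - 1 = nat (- (n + 1))" by simp
  with True show ?thesis
    by (simp add: series_neg_def sigma_minus_bar_fock wedge_sigma_minus_bar_nth)
qed (auto simp: series_neg_def sigma_minus_bar_fock wedge_sigma_minus_bar_nth wedge_right)

lemma finite_sminus: "finite {n. sminus \<phi> n \<noteq> 0}"
proof (induction \<phi> rule: fock_induct)
  case (vac m)
  have "{n. sminus (vac m) n \<noteq> 0} \<subseteq> {0}" by (auto simp: sminus_vac)
  then show ?case by (rule finite_subset) simp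
next
  case (diff \<phi> \<psi>)
  have "{n. sminus (\<phi> - \<psi>) n \<noteq> 0} \<subseteq> {n. sminus \<phi> n \<noteq> 0} \<union> {n. sminus \<psi> n \<noteq> 0}"
    by (auto simp: sminus_additive)
  then show ?case by (rule finite_subset) (simp add: diff)
next
  case (bvec i \<phi>)
  have "{n. sminus (bvec i \<and>\<^sub>F \<phi>) n \<noteq> 0}
      \<subseteq> {n. sminus \<phi> n \<noteq> 0} \<union> (\<lambda>n. n - 1) ` {n. sminus \<phi> n \<noteq> 0}"
  proof
    fix n assume "n \<in> {n. sminus (bvec i \<and>\<^sub>F \<phi>) n \<noteq> 0}"
    then have "sminus \<phi> n \<noteq> 0 \<or> sminus \<phi> (n + 1) \<noteq> 0"
      by (auto simp: sminus_bvec wedge_right)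
    then show "n \<in> {n. sminus \<phi> n \<noteq> 0} \<union> (\<lambda>n. n - 1) ` {n. sminus \<phi> n \<noteq> 0}"
      by (auto intro!: image_eqI[of _ _ "n + 1"])
  qed
  then show ?case by (rule finite_subset) (simp add: bvec)
qed

text \<open>Whatever coefficient \<open>h l\<close> is read off, the support in \<open>l\<close> is
  bounded by that of \<open>sminus\<close>.\<close>

lemma finite_splus_sminus:
  "finite {l. splus (sminus \<phi> l) (h l) \<noteq> 0}"
  "finite {l. splus (u \<and>\<^sub>F sminus \<phi> l) (h l) \<noteq> 0}"
  by (rule finite_subset[OF _ finite_sminus[of \<phi>]]; auto simp: splus_additive wedge_right)+

lemma sigma_sigma_diff: "sigma_sigma (\<phi> - \<psi>) k = sigma_sigma \<phi> k - sigma_sigma \<psi> k"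
  by (simp add: sigma_sigma_eq sminus_additive splus_additive Sum_any_diff finite_splus_sminus)

lemma sigma_sigma_vac: "sigma_sigma (vac m) k = splus (vac m) k"
proof -
  have "splus (sminus (vac m) l) (k - l) = (if l = 0 then splus (vac m) k else 0)" for l
    by (simp add: sminus_vac splus_additive)
  then show ?thesis by (simp add: sigma_sigma_eq)
qed

text \<open>The generating-function identity
  \<open>\<sigma>\<^sub>+(z) (b\<^sub>i - z\<^sup>-\<^sup>1 b\<^sub>i\<^sub>-\<^sub>1) = - z\<^sup>-\<^sup>1 b\<^sub>i\<^sub>-\<^sub>1\<close>, coefficientwise.\<close>

lemma sigma_sigma_bvec: "sigma_sigma (bvec i \<and>\<^sub>F \<phi>) k = - (bvec (i - 1) \<and>\<^sub>F sigma_sigma \<phi> (k + 1))"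
proof -
  let ?q = "sminus \<phi>"
  have "sigma_sigma (bvec i \<and>\<^sub>F \<phi>) k
      = (\<Sum>l. splus (bvec i \<and>\<^sub>F ?q l) (k - l) - splus (bvec (i - 1) \<and>\<^sub>F ?q (l + 1)) (k + 1 - (l + 1)))"
    by (simp add: sigma_sigma_eq sminus_bvec splus_additive)
  also have "\<dots> = (\<Sum>l. splus (bvec i \<and>\<^sub>F ?q l) (k - l))
      - (\<Sum>l. splus (bvec (i - 1) \<and>\<^sub>F ?q (l + 1)) (k + 1 - (l + 1)))"
  proof (rule Sum_any_diff)
    have "{l. splus (bvec (i - 1) \<and>\<^sub>F ?q (l + 1)) (k + 1 - (l + 1)) \<noteq> 0} \<subseteq> (\<lambda>n. n - 1) ` {n. ?q n \<noteq> 0}"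
    proof
      fix l assume "l \<in> {l. splus (bvec (i - 1) \<and>\<^sub>F ?q (l + 1)) (k + 1 - (l + 1)) \<noteq> 0}"
      then have "?q (l + 1) \<noteq> 0" by (auto simp: wedge_right splus_additive)
      then show "l \<in> (\<lambda>n. n - 1) ` {n. ?q n \<noteq> 0}" by (auto intro!: image_eqI[of _ _ "l + 1"])
    qed
    then show "finite {l. splus (bvec (i - 1) \<and>\<^sub>F ?q (l + 1)) (k + 1 - (l + 1)) \<noteq> 0}"
      by (rule finite_subset) (simp add: finite_sminus)
  qed (simp add: finite_splus_sminus wedge_right splus_additive)
  also have "(\<Sum>l. splus (bvec (i - 1) \<and>\<^sub>F ?q (l + 1)) (k + 1 - (l + 1)))
      = (\<Sum>l. splus (bvec (i - 1) \<and>\<^sub>F ?q l) (k + 1 - l))"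
    by (rule Sum_any_shift)
  also have "(\<Sum>l. splus (bvec i \<and>\<^sub>F ?q l) (k - l)) - \<dots>
      = (\<Sum>l. splus (bvec i \<and>\<^sub>F ?q l) (k - l) - splus (bvec (i - 1) \<and>\<^sub>F ?q l) (k + 1 - l))"
    by (rule Sum_any_diff[symmetric]) (simp_all add: finite_splus_sminus wedge_right splus_additive)
  also have "\<dots> = (\<Sum>l. - (bvec (i - 1) \<and>\<^sub>F splus (?q l) (k + 1 - l)))"
  proof -
    have "splus (bvec i \<and>\<^sub>F ?q l) (k - l) - splus (bvec (i - 1) \<and>\<^sub>F ?q l) (k + 1 - l)
        = - (bvec (i - 1) \<and>\<^sub>F splus (?q l) (k + 1 - l))" for l
      using splus_bvec_pred[of i "?q l" "k - l"] by (simp add: algebra_simps)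
    then show ?thesis by simp
  qed
  also have "\<dots> = - (bvec (i - 1) \<and>\<^sub>F sigma_sigma \<phi> (k + 1))"
    unfolding sigma_sigma_eq
    by (rule Sum_any_additive[where f = "\<lambda>\<phi>. - (bvec (i - 1) \<and>\<^sub>F \<phi>)", symmetric])
      (simp_all add: wedge_add_right finite_splus_sminus splus_additive)
  finally show ?thesis .
qed

lemma rcoeff_bvec: "rcoeff (bvec i \<and>\<^sub>F \<phi>) n = bvec (i + 1) \<and>\<^sub>F rcoeff \<phi> (n - 1)"
  by (simp add: R_fock lookup_R_bvec)

lemma rcoeff_vac: "rcoeff (vac m) n = (if n = m + 1 then vac (m + 1) else 0)"
  by (auto simp: R_fock lookup_single)

text \<open>\<open>J\<close> bounds the powers of \<open>z\<close> that \<open>R(z)\<close>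
  produces, uniformly in \<open>k\<close>: a vacuum contributes one exponent, and wedging with a
  basis vector shifts all of them by one.\<close>

lemma rcoeff_sigma_sigma_support:
  "\<exists>J. finite J \<and> (\<forall>k. \<forall>n. n \<notin> J \<longrightarrow> rcoeff (sigma_sigma \<phi> k) n = 0)"
proof (induction \<phi> rule: fock_induct)
  case (vac m)
  show ?case
    by (intro exI[of _ "{m + 1}"])
      (auto simp: sigma_sigma_vac splus_vac rcoeff_bvec rcoeff_vac rcoeff_additive wedge_right)
next
  case (diff \<phi> \<psi>)
  then obtain J K where "finite J" "finite K"
    "\<forall>k. \<forall>n. n \<notin> J \<longrightarrow> rcoeff (sigma_sigma \<phi> k) n = 0"
    "\<forall>k. \<forall>n. n \<notin> K \<longrightarrow> rcoeff (sigma_sigma \<psi> k) n = 0" by blast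
  then show ?case
    by (intro exI[of _ "J \<union> K"]) (simp add: sigma_sigma_diff rcoeff_additive)
next
  case (bvec i \<phi>)
  then obtain J where J: "finite J" "\<forall>k. \<forall>n. n \<notin> J \<longrightarrow> rcoeff (sigma_sigma \<phi> k) n = 0" by blast
  have "n - 1 \<notin> J" if "n \<notin> (\<lambda>n. n + 1) ` J" for n
    using that by (auto simp: image_iff)
  with J show ?case
    by (intro exI[of _ "(\<lambda>n. n + 1) ` J"])
      (auto simp: sigma_sigma_bvec rcoeff_additive rcoeff_bvec wedge_right)
qed

lemma finite_rcoeff_sigma_sigma: "finite {k. rcoeff (sigma_sigma \<phi> k) (n - k) \<noteq> 0}"
proof -
  obtain J where J: "finite J" "\<forall>k. \<forall>n. n \<notin> J \<longrightarrow> rcoeff (sigma_sigma \<phi> k) n = 0"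
    using rcoeff_sigma_sigma_support by blast
  have "{k. rcoeff (sigma_sigma \<phi> k) (n - k) \<noteq> 0} \<subseteq> (\<lambda>j. n - j) ` J"
  proof
    fix k assume "k \<in> {k. rcoeff (sigma_sigma \<phi> k) (n - k) \<noteq> 0}"
    with J(2) have "n - k \<in> J" by auto
    then show "k \<in> (\<lambda>j. n - j) ` J" by (rule image_eqI[rotated]) simp
  qed
  with J(1) show ?thesis by (auto intro: finite_subset)
qed

lemma R_op_sigma_sigma: "R_op (sigma_sigma \<phi>) n = (\<Sum>k. rcoeff (sigma_sigma \<phi> k) (n - k))"
  by (simp add: R_op_def coeffwise_def)

theorem proposition6p9:
  fixes \<phi> :: fock
  shows "wedge_series bseries \<phi> = R_op (sigma_plus_op (series_neg (sigma_minus_bar_fock \<phi>)))"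
proof
  fix n
  show "wedge_series bseries \<phi> n = R_op (sigma_sigma \<phi>) n"
  proof (induction \<phi> rule: fock_induct)
    case (vac m)
    \<comment> \<open>\<open>R(z)\<close> sends the coefficient \<open>bvec (m + k)\<close> wedge
      \<open>vac (m - 1)\<close> to exponent \<open>m + 1\<close>, which forces
      \<open>k = n - m - 1\<close> and the letter \<open>n\<close>. If this \<open>k\<close> is
      negative then \<open>n \<le> m\<close>, and \<open>bvec n\<close> kills
      \<open>vac m\<close>.\<close>
    have "rcoeff (sigma_sigma (vac m) k) (n - k)
        = (if k = n - m - 1 then bvec n \<and>\<^sub>F vac m else 0)" for k
      using bvec_wedge_vac_eq_0[of n m]
      by (auto simp: sigma_sigma_vac splus_vac rcoeff_bvec rcoeff_vac rcoeff_additive wedge_right)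
    then show ?case
      by (simp add: R_op_sigma_sigma wedge_series_def bseries_def)
  next
    case (diff \<phi> \<psi>)
    have "R_op (sigma_sigma (\<phi> - \<psi>)) n = R_op (sigma_sigma \<phi>) n - R_op (sigma_sigma \<psi>) n"
      by (simp add: R_op_sigma_sigma sigma_sigma_diff rcoeff_additive Sum_any_diff
          finite_rcoeff_sigma_sigma)
    with diff show ?case by (simp add: wedge_series_def wedge_right)
  next
    case (bvec i \<phi>)
    \<comment> \<open>\<open>R(z)\<close> raises \<open>bvec (i - 1)\<close> back to
      \<open>bvec i\<close>, and its factor \<open>z\<close> turns the exponent \<open>n - k\<close>
      into \<open>n - (k + 1)\<close>.\<close>
    have "R_op (sigma_sigma (bvec i \<and>\<^sub>F \<phi>)) n
        = (\<Sum>k. - (bvec i \<and>\<^sub>F rcoeff (sigma_sigma \<phi> (k + 1)) (n - (k + 1))))"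
      by (simp add: R_op_sigma_sigma sigma_sigma_bvec rcoeff_additive rcoeff_bvec algebra_simps)
    also have "\<dots> = (\<Sum>k. - (bvec i \<and>\<^sub>F rcoeff (sigma_sigma \<phi> k) (n - k)))"
      by (rule Sum_any_shift)
    also have "\<dots> = - (bvec i \<and>\<^sub>F R_op (sigma_sigma \<phi>) n)"
      unfolding R_op_sigma_sigma
      by (rule Sum_any_additive[where f = "\<lambda>\<phi>. - (bvec i \<and>\<^sub>F \<phi>)", symmetric])
        (simp_all add: wedge_add_right finite_rcoeff_sigma_sigma)
    also have "\<dots> = - (bvec i \<and>\<^sub>F bvec n \<and>\<^sub>F \<phi>)"
      using bvec by (simp add: wedge_series_def bseries_def)
    finally show ?case
      using bvec_wedge_anticommute[of n i \<phi>] by (simp add: wedge_series_def bseries_def)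
  qed
qed

end
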